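(* Given a maximum induced matching of the input graph, \textsc{Colored Clustering} can be solved in $\mathcal{O}^*(|C|^{\mathcal{O}(k-I(G))})$ time.
   Context: \textsc{Colored Clustering}: given a graph $G=(V,E)$, an edge coloring $\ell\colon E\to C$ ($C$ a finite color set), and $k\in\mathbb{N}$, decide whether there is a stable $F\subseteq E$ with $|F|\ge k$; $F$ is stable if $\ell(e)=\ell(e')$ whenever $e,e'\in F$ share a vertex. A matching $M$ is induced if no two vertices belonging to distinct edges of $M$ are adjacent; $I(G)$ is the size of a maximum induced matching of $G$. $\mathcal{O}^*$ hides polynomial factors in the input size. *)

theory Defs
  imports Main
begin

section \<open>Colored Clustering\<close>

text \<open>Undirected edges are two-element vertex sets, so graphs are finite and simple.\<close>

definition simple_graph :: "'v set \<Rightarrow> 'v set set \<Rightarrow> bool" where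
  "simple_graph V E \<longleftrightarrow> finite V \<and> (\<forall>e\<in>E. e \<subseteq> V \<and> card e = 2)"

definition stable :: "('v set \<Rightarrow> 'c) \<Rightarrow> 'v set set \<Rightarrow> bool" where
  "stable l F \<longleftrightarrow> (\<forall>e\<in>F. \<forall>e'\<in>F. e \<inter> e' \<noteq> {} \<longrightarrow> l e = l e')"

definition colored_clustering :: "'v set set \<Rightarrow> ('v set \<Rightarrow> 'c) \<Rightarrow> nat \<Rightarrow> bool" where
  "colored_clustering E l k \<longleftrightarrow> (\<exists>F. F \<subseteq> E \<and> stable l F \<and> card F \<ge> k)"

definition matching :: "'v set set \<Rightarrow> 'v set set \<Rightarrow> bool" where
  "matching E M \<longleftrightarrow> M \<subseteq> E \<and> (\<forall>e\<in>M. \<forall>e'\<in>M. e \<noteq> e' \<longrightarrow> e \<inter> e' = {})"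

definition induced_matching :: "'v set set \<Rightarrow> 'v set set \<Rightarrow> bool" where
  "induced_matching E M \<longleftrightarrow> matching E M \<and>
     (\<forall>e\<in>M. \<forall>e'\<in>M. e \<noteq> e' \<longrightarrow> (\<forall>u\<in>e. \<forall>v\<in>e'. {u, v} \<notin> E))"

definition maximum_induced_matching :: "'v set set \<Rightarrow> 'v set set \<Rightarrow> bool" where
  "maximum_induced_matching E M \<longleftrightarrow> induced_matching E M \<and>
     (\<forall>M'. induced_matching E M' \<longrightarrow> card M' \<le> card M)"

definition induced_matching_number :: "'v set set \<Rightarrow> nat" where
  "induced_matching_number E = Max (card ` {M. induced_matching E M})"


section \<open>Model of computation\<close>

text \<open>
  A first-order, call-by-value functional language over binary trees, in the style of the languages
  in N. D. Jones, Computability and Complexity from a Programming Perspective. A program is a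
  finite list of mutually recursive function bodies. The only primitives are building a pair,
  taking it apart, and testing for the atom; there is no built-in arithmetic and no equality test on
  trees. The running time is the number of rule applications in the evaluation. With values
  represented as pointers to shared cells each rule costs constantly many pointer operations, so
  running times agree with those of Turing machines up to a polynomial. Bounds of the form
  (polynomial in the input size) * q ^ O(r) do not change under such a polynomial overhead.
\<close>

datatype data = Atom | Pair data data

datatype exp =
    Var nat
  | EAtom
  | EPair exp exp
  | Fst exp
  | Snd exp
  | IfPair exp exp exp
  | LetIn exp exp
  | Call nat "exp list"

type_synonym program = "exp list"

fun fst_data :: "data \<Rightarrow> data" where
  "fst_data Atom = Atom"
| "fst_data (Pair v w) = v"

fun snd_data :: "data \<Rightarrow> data" where
  "snd_data Atom = Atom"
| "snd_data (Pair v w) = w"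

text \<open>
  \<open>evalto P env e v t\<close>: in program \<open>P\<close>, with de Bruijn environment \<open>env\<close>, the expression \<open>e\<close>
  evaluates to \<open>v\<close> in exactly \<open>t\<close> steps. Diverging evaluations and unbound indices have no
  derivation.
\<close>

inductive evalto :: "program \<Rightarrow> data list \<Rightarrow> exp \<Rightarrow> data \<Rightarrow> nat \<Rightarrow> bool"
  and evalsto :: "program \<Rightarrow> data list \<Rightarrow> exp list \<Rightarrow> data list \<Rightarrow> nat \<Rightarrow> bool"
  for P :: program where
  eval_Var: "i < length env \<Longrightarrow> evalto P env (Var i) (env ! i) 1"
| eval_EAtom: "evalto P env EAtom Atom 1"
| eval_EPair: "evalto P env e1 v1 t1 \<Longrightarrow> evalto P env e2 v2 t2 \<Longrightarrow>
    evalto P env (EPair e1 e2) (Pair v1 v2) (t1 + t2 + 1)"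
| eval_Fst: "evalto P env e v t \<Longrightarrow> evalto P env (Fst e) (fst_data v) (t + 1)"
| eval_Snd: "evalto P env e v t \<Longrightarrow> evalto P env (Snd e) (snd_data v) (t + 1)"
| eval_If_Pair: "evalto P env e (Pair x y) t \<Longrightarrow> evalto P env e1 v t1 \<Longrightarrow>
    evalto P env (IfPair e e1 e2) v (t + t1 + 1)"
| eval_If_Atom: "evalto P env e Atom t \<Longrightarrow> evalto P env e2 v t2 \<Longrightarrow>
    evalto P env (IfPair e e1 e2) v (t + t2 + 1)"
| eval_LetIn: "evalto P env e1 v1 t1 \<Longrightarrow> evalto P (v1 # env) e2 v2 t2 \<Longrightarrow>
    evalto P env (LetIn e1 e2) v2 (t1 + t2 + 1)"
| eval_Call: "evalsto P env es vs t1 \<Longrightarrow> f < length P \<Longrightarrow> evalto P vs (P ! f) v t2 \<Longrightarrow>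
    evalto P env (Call f es) v (t1 + t2 + 1)"
| evals_Nil: "evalsto P env [] [] 1"
| evals_Cons: "evalto P env e v t1 \<Longrightarrow> evalsto P env es vs t2 \<Longrightarrow>
    evalsto P env (e # es) (v # vs) (t1 + t2 + 1)"

definition runs :: "program \<Rightarrow> data \<Rightarrow> data \<Rightarrow> nat \<Rightarrow> bool" where
  "runs P x v t \<longleftrightarrow> evalto P [x] (Call 0 [Var 0]) v t"

definition accepts :: "program \<Rightarrow> data \<Rightarrow> nat \<Rightarrow> bool" where
  "accepts P x t \<longleftrightarrow> (\<exists>v. runs P x v t \<and> v \<noteq> Atom)"

definition rejects :: "program \<Rightarrow> data \<Rightarrow> nat \<Rightarrow> bool" where
  "rejects P x t \<longleftrightarrow> runs P x Atom t"

inductive_cases eval_VarE: "evalto P env (Var i) v t"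
inductive_cases eval_EAtomE: "evalto P env EAtom v t"
inductive_cases eval_EPairE: "evalto P env (EPair e1 e2) v t"
inductive_cases eval_FstE: "evalto P env (Fst e) v t"
inductive_cases eval_SndE: "evalto P env (Snd e) v t"
inductive_cases eval_IfE: "evalto P env (IfPair e e1 e2) v t"
inductive_cases eval_LetInE: "evalto P env (LetIn e1 e2) v t"
inductive_cases eval_CallE: "evalto P env (Call f es) v t"
inductive_cases evals_NilE: "evalsto P env [] vs t"
inductive_cases evals_ConsE: "evalsto P env (e # es) vs t"

lemma evalto_deterministic:
  "evalto P env e v t \<Longrightarrow> (\<And>v' t'. evalto P env e v' t' \<Longrightarrow> v' = v \<and> t' = t)"
  "evalsto P env es vs t \<Longrightarrow> (\<And>vs' t'. evalsto P env es vs' t' \<Longrightarrow> vs' = vs \<and> t' = t)"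
proof (induction rule: evalto_evalsto.inducts)
  case eval_Var then show ?case by (auto elim: eval_VarE)
next
  case eval_EAtom then show ?case by (auto elim: eval_EAtomE)
next
  case (eval_EPair env e1 v1 t1 e2 v2 t2)
  from eval_EPair.prems show ?case
    by (rule eval_EPairE) (auto dest!: eval_EPair.IH(2,4))
next
  case (eval_Fst env e v t)
  from eval_Fst.prems show ?case
    by (rule eval_FstE) (auto dest!: eval_Fst.IH(2))
next
  case (eval_Snd env e v t)
  from eval_Snd.prems show ?case
    by (rule eval_SndE) (auto dest!: eval_Snd.IH(2))
next
  case (eval_If_Pair env e x y t e1 v t1 e2)
  from eval_If_Pair.prems show ?case
    by (rule eval_IfE) (auto dest!: eval_If_Pair.IH(2,4))+
next
  case (eval_If_Atom env e t e2 v t2 e1)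
  from eval_If_Atom.prems show ?case
    by (rule eval_IfE) (auto dest!: eval_If_Atom.IH(2,4))+
next
  case (eval_LetIn env e1 v1 t1 e2 v2 t2)
  from eval_LetIn.prems show ?case
    by (rule eval_LetInE) (auto dest!: eval_LetIn.IH(2,4))
next
  case (eval_Call env es vs t1 f v t2)
  from eval_Call.prems show ?case
    by (rule eval_CallE) (auto dest!: eval_Call.IH(2,5))
next
  case evals_Nil then show ?case by (auto elim: evals_NilE)
next
  case (evals_Cons env e v t1 es vs t2)
  from evals_Cons.prems show ?case
    by (rule evals_ConsE) (auto dest!: evals_Cons.IH(2,4))
qed


section \<open>Encoding of inputs\<close>

text \<open>Numbers (vertex names, colors and \<open>k\<close>) are written in binary, least significant bit first.\<close>

fun enc_nat :: "nat \<Rightarrow> data" where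
  "enc_nat n = (if n = 0 then Atom
     else Pair (if odd n then Pair Atom Atom else Atom) (enc_nat (n div 2)))"

declare enc_nat.simps [simp del]

fun enc_list :: "('a \<Rightarrow> data) \<Rightarrow> 'a list \<Rightarrow> data" where
  "enc_list enc [] = Atom"
| "enc_list enc (x # xs) = Pair (enc x) (enc_list enc xs)"

fun edge_of :: "'v \<times> 'v \<Rightarrow> 'v set" where
  "edge_of (u, v) = {u, v}"

text \<open>\<open>lists_edges ps E\<close>: every edge of \<open>E\<close> occurs exactly once in \<open>ps\<close>, in one of its two orientations.\<close>

definition lists_edges :: "('v \<times> 'v) list \<Rightarrow> 'v set set \<Rightarrow> bool" where
  "lists_edges ps E \<longleftrightarrow> distinct (map edge_of ps) \<and> edge_of ` set ps = E"

fun enc_edge :: "nat \<times> nat \<Rightarrow> data" where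
  "enc_edge (u, v) = Pair (enc_nat u) (enc_nat v)"

fun enc_colored_edge :: "(nat set \<Rightarrow> nat) \<Rightarrow> nat \<times> nat \<Rightarrow> data" where
  "enc_colored_edge l (u, v) = Pair (enc_edge (u, v)) (enc_nat (l {u, v}))"

text \<open>
  \<open>x\<close> is a description of the graph, the color set, the coloring, the number \<open>k\<close> and the edge
  set \<open>M\<close>. The vertices, edges and colors may be listed in any order.
\<close>

definition encodes ::
  "data \<Rightarrow> nat set \<Rightarrow> nat set set \<Rightarrow> nat set \<Rightarrow> (nat set \<Rightarrow> nat) \<Rightarrow> nat \<Rightarrow> nat set set \<Rightarrow> bool" where
  "encodes x V E C l k M \<longleftrightarrow>
     (\<exists>vs es cs ms.
        distinct vs \<and> set vs = V \<and>
        lists_edges es E \<and>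
        distinct cs \<and> set cs = C \<and>
        lists_edges ms M \<and>
        x = Pair (enc_list enc_nat vs)
             (Pair (enc_list (enc_colored_edge l) es)
               (Pair (enc_list enc_nat cs)
                 (Pair (enc_nat k) (enc_list enc_edge ms)))))"

text \<open>The input size is \<open>size x\<close>, the number of \<^const>\<open>Pair\<close> nodes of \<open>x\<close>.\<close>

text \<open>
  \<open>T\<close> is an \<open>O\<^sup>*(q ^ O(r))\<close> time bound, for quantities \<open>q\<close> and \<open>r\<close> of inputs of size \<open>n\<close>:
  one choice of constants serves for all inputs. Base \<open>0\<close> is read as \<open>1\<close>, since otherwise
  the degenerate case \<open>q = 0\<close>, \<open>r > 0\<close> would demand running time \<open>0\<close>.
\<close>

definition O_star_bound :: "nat \<Rightarrow> nat \<Rightarrow> nat \<Rightarrow> nat \<Rightarrow> nat \<Rightarrow> nat \<Rightarrow> nat" where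
  "O_star_bound a b c n q r = a * n ^ b * max 1 q ^ (c * r)"

end

theory Submission
  imports Defs
begin

text \<open>
  Put \<open>d = k - |M|\<close>, and call a vertex pair of \<open>M\<close> simply a pair. Starting from (the consistent
  part of) \<open>M\<close>, a local search improves a stable edge set \<open>F\<close> by inserting at most two edges,
  removing what conflicts with them, and extending greedily. Each improvement destroys at most
  four pairs, so if \<open>F\<close> stays below \<open>k\<close> edges, it differs from \<open>M\<close> in \<open>O(d)\<close> edges only. The
  vertices of these edges, together with the pairs they touch, are the critical vertices; all
  their colorings are enumerated.

  Follow the branch of a coloring \<open>f\<close> induced by a solution \<open>F*\<close>. Let \<open>U1\<close> be the critical vertices
  of the first stage and \<open>U2\<close> those of the first two stages, the second stage being restricted to the
  edges consistent with the coloring of \<open>U1\<close>. Outside \<open>U1\<close> and the pairs there remains an independent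
  set \<open>W1\<close>, outside \<open>U2\<close> and the pairs a subset \<open>W2\<close> of it. By local optimality of the first stage,
  \<open>F*\<close> has at most one edge inside \<open>p \<union> W1\<close> that meets a remaining pair \<open>p\<close>, and by that of the
  second at most one inside \<open>p \<union> U1 \<union> W2\<close>. Hence \<open>F*\<close> has at most two edges at \<open>p\<close>, and if it has
  two, both end in \<open>U2\<close>. So the edges between the pairs and \<open>W2\<close> may be ignored in the last stage,
  where the graph outside \<open>U2\<close> falls apart into single edges and vertices, and a local optimum
  is a global one.
\<close>

section \<open>Local search for stable edge sets\<close>

text \<open>Accepting as soon as a stage reaches \<open>k\<close> edges turns the gap
  \<open>d\<close> into a structural bound: a search that ends below \<open>k\<close> made few
  improvements, apart from those paid for by pairs that the colouring had already destroyed. So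
  every colouring step adds a number of vertices linear in \<open>d\<close> and in the number
  already coloured, and a fixed number of such steps keeps the exponent linear in \<open>d\<close>.

  One step is not enough. After it, a remaining pair may still have one solution edge to
  \<open>U1\<close> and another to \<open>W1\<close>; dropping the latter loses an edge, and keeping
  all such edges lets an exchange at one pair disturb others through a shared vertex. The second
  step colours the end of the latter edge in exactly this case. An edge to \<open>W2\<close> is then
  the only solution edge at its pair, and the pair itself can replace it.

  Two insertions alone would not suffice at a vertex \<open>w\<close> of \<open>W2\<close>, where
  the solution may have a star of any size, all of one colour. The greedy extension covers this: one
  inserted edge of the star shuts out everything that conflicts with the others, so the whole star
  enters.\<close>

type_synonym ('v, 'c) cedge = "('v \<times> 'v) \<times> 'c"

definition ends :: "('v, 'c) cedge \<Rightarrow> 'v set" where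
  "ends e = edge_of (fst e)"

definition conflict :: "('v, 'c) cedge \<Rightarrow> ('v, 'c) cedge \<Rightarrow> bool" where
  "conflict e f \<longleftrightarrow> ends e \<inter> ends f \<noteq> {} \<and> snd e \<noteq> snd f"

definition conflict_free :: "('v, 'c) cedge set \<Rightarrow> bool" where
  "conflict_free F \<longleftrightarrow> (\<forall>e\<in>F. \<forall>f\<in>F. \<not> conflict e f)"

lemma ends_simp [simp]: "ends ((u, v), c) = {u, v}"
  by (simp add: ends_def)

lemma ends_nonempty [simp]: "ends e \<noteq> {}"
  by (cases e; cases "fst e") auto

lemma finite_ends [simp]: "finite (ends e)"
  by (cases e; cases "fst e") auto

lemma card_ends_le: "card (ends e) \<le> 2"
  by (cases e; cases "fst e") (auto simp: card_insert_if)

lemma ends_subset_Un: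
  assumes "ends e \<inter> A \<noteq> {}" "ends e \<inter> B \<noteq> {}" "A \<inter> B = {}"
  shows "ends e \<subseteq> A \<union> B"
  using assms by (cases e; cases "fst e") auto

lemma conflict_commute: "conflict e f \<longleftrightarrow> conflict f e"
  by (auto simp: conflict_def)

lemma conflict_irrefl [simp]: "\<not> conflict e e"
  by (auto simp: conflict_def)

text \<open>Equality counts as blocking, which keeps greedy lists free of repetitions; their length
  is then the number of edges.\<close>

definition blocked :: "('v, 'c) cedge \<Rightarrow> ('v, 'c) cedge list \<Rightarrow> bool" where
  "blocked e acc \<longleftrightarrow> (\<exists>f\<in>set acc. f = e \<or> conflict e f)"

fun extend :: "('v, 'c) cedge list \<Rightarrow> ('v, 'c) cedge list \<Rightarrow> ('v, 'c) cedge list" where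
  "extend acc [] = acc"
| "extend acc (e # es) = (if blocked e acc then extend acc es else extend (e # acc) es)"

lemma extend_superset: "set acc \<subseteq> set (extend acc es)"
proof (induction es arbitrary: acc)
  case (Cons e es)
  show ?case
    using Cons.IH[of acc] Cons.IH[of "e # acc"] by simp
qed simp

lemma extend_subset: "set (extend acc es) \<subseteq> set acc \<union> set es"
proof (induction es arbitrary: acc)
  case (Cons e es)
  show ?case
    using Cons.IH[of acc] Cons.IH[of "e # acc"] by (simp, blast)
qed simp

lemma extend_distinct: "distinct acc \<Longrightarrow> distinct (extend acc es)"
proof (induction es arbitrary: acc)
  case (Cons e es)
  moreover have "e \<notin> set acc" if "\<not> blocked e acc"
    using that unfolding blocked_def by blast
  ultimately show ?case by simp
qed simp

lemma extend_conflict_free: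
  "conflict_free (set acc) \<Longrightarrow> conflict_free (set (extend acc es))"
proof (induction es arbitrary: acc)
  case (Cons e es)
  moreover have "conflict_free (set (e # acc))" if "\<not> blocked e acc"
    using that Cons.prems conflict_commute[of _ e]
    unfolding conflict_free_def blocked_def by simp
  ultimately show ?case by simp
qed simp

text \<open>Only an accumulated edge can cause a refusal, and accumulated edges are never removed;
  so a refusal because of a conflict leaves a trace in the result.\<close>

lemma extend_mem:
  "e \<in> set es \<Longrightarrow> (\<And>f. f \<in> set (extend acc es) \<Longrightarrow> \<not> conflict e f) \<Longrightarrow> e \<in> set (extend acc es)"
proof (induction es arbitrary: acc)
  case (Cons e' es)
  let ?acc = "if blocked e' acc then acc else e' # acc"
  have eq: "extend acc (e' # es) = extend ?acc es"
    by simp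
  show ?case
  proof (cases "e \<in> set es")
    case True
    show ?thesis
      unfolding eq by (rule Cons.IH[OF True]) (rule Cons.prems(2)[unfolded eq])
  next
    case False
    with Cons.prems have [simp]: "e' = e" by simp
    have sup: "set ?acc \<subseteq> set (extend ?acc es)"
      by (rule extend_superset)
    show ?thesis
    proof (cases "blocked e acc")
      case True
      then obtain f where f: "f \<in> set acc" "f = e \<or> conflict e f"
        unfolding blocked_def by (elim bexE)
      have "f \<in> set (extend acc (e' # es))"
        unfolding eq using sup f(1) by (auto split: if_splits)
      then show ?thesis
        using f(2) Cons.prems(2)[of f] by (elim disjE) simp_all
    qed (use sup in \<open>simp add: eq\<close>)
  qed
qed simp

text \<open>The order of the passes is the priority: the seeds oust what conflicts with them, the
  rest of \<open>F\<close> survives, and \<open>L\<close> fills the gaps. If the seeds conflict,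
  only the first enters.\<close>

definition exchange ::
  "('v, 'c) cedge \<Rightarrow> ('v, 'c) cedge \<Rightarrow> ('v, 'c) cedge list \<Rightarrow> ('v, 'c) cedge list \<Rightarrow>
    ('v, 'c) cedge list" where
  "exchange e1 e2 F L = extend (extend (extend [] [e1, e2]) F) L"

lemma exchange_distinct: "distinct (exchange e1 e2 F L)"
  unfolding exchange_def by (intro extend_distinct) simp

lemma exchange_conflict_free: "conflict_free (set (exchange e1 e2 F L))"
  unfolding exchange_def by (intro extend_conflict_free) (simp add: conflict_free_def)

lemma exchange_subset: "set (exchange e1 e2 F L) \<subseteq> {e1, e2} \<union> set F \<union> set L"
  unfolding exchange_def
  using extend_subset[of "extend (extend [] [e1, e2]) F" L]
    extend_subset[of "extend [] [e1, e2]" F] extend_subset[of "[]" "[e1, e2]"]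
  by (simp del: extend.simps) blast

lemma exchange_seeds:
  assumes "\<not> conflict e1 e2"
  shows "{e1, e2} \<subseteq> set (exchange e1 e2 F L)"
proof -
  have "set (extend [] [e1, e2]) = {e1, e2}"
    using assms by (auto simp: conflict_commute blocked_def)
  then show ?thesis
    unfolding exchange_def by (metis extend_superset order_trans)
qed

lemma exchange_retains:
  assumes "conflict_free (set F)" "f \<in> set F" "\<not> conflict e1 f" "\<not> conflict e2 f"
  shows "f \<in> set (exchange e1 e2 F L)"
proof -
  have "f \<in> set (extend (extend [] [e1, e2]) F)"
  proof (rule extend_mem[OF assms(2)])
    fix g assume "g \<in> set (extend (extend [] [e1, e2]) F)"
    then have "g \<in> {e1, e2} \<union> set F"
      using extend_subset[of "extend [] [e1, e2]" F] extend_subset[of "[]" "[e1, e2]"] by auto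
    then show "\<not> conflict f g"
      using assms by (auto simp: conflict_free_def conflict_commute)
  qed
  then show ?thesis
    unfolding exchange_def using extend_superset by blast
qed

lemma exchange_saturates:
  "e \<in> set L \<Longrightarrow> (\<And>f. f \<in> set (exchange e1 e2 F L) \<Longrightarrow> \<not> conflict e f) \<Longrightarrow>
    e \<in> set (exchange e1 e2 F L)"
  unfolding exchange_def by (rule extend_mem)

text \<open>The set \<open>S\<close> consists of edges that are forced into the greedy extension of \<open>e1\<close> and \<open>e2\<close>.\<close>

definition local_optimum :: "('v, 'c) cedge set \<Rightarrow> ('v, 'c) cedge set \<Rightarrow> bool" where
  "local_optimum L F \<longleftrightarrow> F \<subseteq> L \<and> finite F \<and> conflict_free F \<and>
     (\<forall>e1\<in>L. \<forall>e2\<in>L. \<forall>S\<subseteq>L. \<not> conflict e1 e2 \<longrightarrow>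
       (\<forall>s\<in>S. \<forall>g\<in>L. conflict s g \<longrightarrow> conflict e1 g \<or> conflict e2 g) \<longrightarrow>
       card (S \<union> {f\<in>F. \<not> conflict e1 f \<and> \<not> conflict e2 f}) \<le> card F)"

lemma local_optimumD:
  assumes "local_optimum L F" "e1 \<in> L" "e2 \<in> L" "S \<subseteq> L" "\<not> conflict e1 e2"
    and "\<And>s g. s \<in> S \<Longrightarrow> g \<in> L \<Longrightarrow> conflict s g \<Longrightarrow> conflict e1 g \<or> conflict e2 g"
  shows "card (S \<union> {f\<in>F. \<not> conflict e1 f \<and> \<not> conflict e2 f}) \<le> card F"
proof -
  have "\<forall>s\<in>S. \<forall>g\<in>L. conflict s g \<longrightarrow> conflict e1 g \<or> conflict e2 g"
    using assms(6) by (intro ballI impI)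
  with assms(1)[unfolded local_optimum_def, THEN conjunct2, THEN conjunct2, THEN conjunct2,
      THEN bspec, OF assms(2), THEN bspec, OF assms(3), THEN spec, THEN mp, OF assms(4),
      THEN mp, OF assms(5)]
  show ?thesis by (rule mp)
qed

text \<open>The two seeds may coincide: with \<open>e1 = e2 = e\<close> the exchange adds
  \<open>e\<close> and removes nothing.\<close>

lemma local_optimum_maximal:
  assumes "local_optimum L F" "e \<in> L" "\<And>f. f \<in> F \<Longrightarrow> \<not> conflict e f"
  shows "e \<in> F"
proof (rule ccontr)
  assume "e \<notin> F"
  have "{f\<in>F. \<not> conflict e f \<and> \<not> conflict e f} = F"
    using assms(3) by blast
  then have "card ({e} \<union> F) \<le> card F"
    using local_optimumD[OF assms(1,2,2), of "{e}"] assms(2) by auto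
  moreover have "finite F"
    using assms(1) by (simp add: local_optimum_def)
  ultimately show False
    using \<open>e \<notin> F\<close> by simp
qed

text \<open>Forced edges enter by saturation: an edge of the result in conflict with one of them
  would also conflict with a seed, but the result contains both seeds and is conflict-free.\<close>

lemma local_optimum_exchange:
  assumes "set F \<subseteq> set L" "distinct F" "conflict_free (set F)"
    and "\<And>e1 e2. e1 \<in> set L \<Longrightarrow> e2 \<in> set L \<Longrightarrow> length (exchange e1 e2 F L) \<le> length F"
  shows "local_optimum (set L) (set F)"
  unfolding local_optimum_def
proof (intro conjI ballI allI impI)
  fix e1 e2 S
  assume e: "e1 \<in> set L" "e2 \<in> set L" and S: "S \<subseteq> set L" and nc: "\<not> conflict e1 e2"
    and forced: "\<forall>s\<in>S. \<forall>g\<in>set L. conflict s g \<longrightarrow> conflict e1 g \<or> conflict e2 g"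
  let ?G = "exchange e1 e2 F L"
  have seeds: "{e1, e2} \<subseteq> set ?G"
    using exchange_seeds[OF nc] .
  have sub: "set ?G \<subseteq> set L"
    using exchange_subset[of e1 e2 F L] assms(1) e by auto
  have "S \<subseteq> set ?G"
  proof
    fix s assume s: "s \<in> S"
    show "s \<in> set ?G"
    proof (rule exchange_saturates)
      show "s \<in> set L" using s S by auto
      fix g assume g: "g \<in> set ?G"
      then have "\<not> conflict e1 g" "\<not> conflict e2 g"
        using seeds exchange_conflict_free[of e1 e2 F L] by (auto simp: conflict_free_def)
      then show "\<not> conflict s g"
        using forced s g sub by blast
    qed
  qed
  moreover have "{f\<in>set F. \<not> conflict e1 f \<and> \<not> conflict e2 f} \<subseteq> set ?G"
    using exchange_retains[OF assms(3)] by blast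
  ultimately have "card (S \<union> {f\<in>set F. \<not> conflict e1 f \<and> \<not> conflict e2 f}) \<le> card (set ?G)"
    by (intro card_mono) auto
  also have "\<dots> = length ?G"
    using exchange_distinct distinct_card by blast
  also have "\<dots> \<le> length F"
    using assms(4) e by blast
  also have "\<dots> = card (set F)"
    using assms(2) distinct_card by metis
  finally show "card (S \<union> {f\<in>set F. \<not> conflict e1 f \<and> \<not> conflict e2 f}) \<le> card (set F)" .
qed (use assms in auto)

text \<open>The empty list can signal failure, because an accepted exchange is longer than
  \<open>F\<close> and hence nonempty.\<close>

fun improve_with :: "('v, 'c) cedge \<Rightarrow> ('v, 'c) cedge list \<Rightarrow> ('v, 'c) cedge list \<Rightarrow>
    ('v, 'c) cedge list \<Rightarrow> ('v, 'c) cedge list" where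
  "improve_with e1 [] F L = []"
| "improve_with e1 (e2 # es) F L =
     (let G = exchange e1 e2 F L in if length F < length G then G else improve_with e1 es F L)"

fun improve :: "('v, 'c) cedge list \<Rightarrow> ('v, 'c) cedge list \<Rightarrow>
    ('v, 'c) cedge list \<Rightarrow> ('v, 'c) cedge list" where
  "improve [] F L = []"
| "improve (e1 # es) F L =
     (let G = improve_with e1 L F L in if G \<noteq> [] then G else improve es F L)"

text \<open>The fuel is a list, since the programs have no numbers to count with; the edge list
  itself will serve as the counter.\<close>

fun local_search :: "'a list \<Rightarrow> ('v, 'c) cedge list \<Rightarrow> ('v, 'c) cedge list \<Rightarrow>
    ('v, 'c) cedge list" where
  "local_search [] F L = F"
| "local_search (_ # fuel) F L =
     (let G = improve L F L in if G \<noteq> [] then local_search fuel G L else F)"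

lemma improve_with_Nil:
  "improve_with e1 es F L = [] \<Longrightarrow> e2 \<in> set es \<Longrightarrow> length (exchange e1 e2 F L) \<le> length F"
  by (induction es) (auto simp: Let_def split: if_splits)

lemma improve_with_not_Nil:
  "improve_with e1 es F L \<noteq> [] \<Longrightarrow> \<exists>e2\<in>set es. improve_with e1 es F L = exchange e1 e2 F L \<and>
     length F < length (exchange e1 e2 F L)"
  by (induction es) (auto simp: Let_def split: if_splits)

lemma improve_Nil:
  "improve es F L = [] \<Longrightarrow> e1 \<in> set es \<Longrightarrow> e2 \<in> set L \<Longrightarrow>
    length (exchange e1 e2 F L) \<le> length F"
  by (induction es) (auto simp: Let_def improve_with_Nil split: if_splits)

lemma improve_not_Nil:
  "improve es F L \<noteq> [] \<Longrightarrow> \<exists>e1\<in>set es. \<exists>e2\<in>set L. improve es F L = exchange e1 e2 F L \<and>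
     length F < length (exchange e1 e2 F L)"
  by (induction es) (auto simp: Let_def dest: improve_with_not_Nil split: if_splits)

lemma distinct_subset_length:
  "distinct xs \<Longrightarrow> set xs \<subseteq> set ys \<Longrightarrow> length xs \<le> length ys"
  by (metis List.finite_set card_length card_mono distinct_card order_trans)

lemma local_search_basic:
  assumes "set F \<subseteq> set L" "distinct F" "conflict_free (set F)"
  shows "set (local_search fuel F L) \<subseteq> set L \<and> distinct (local_search fuel F L) \<and>
    conflict_free (set (local_search fuel F L))"
  using assms
proof (induction fuel arbitrary: F)
  case (Cons a fuel)
  show ?case
  proof (cases "improve L F L = []")
    case False
    then obtain e1 e2 where e: "e1 \<in> set L" "e2 \<in> set L" "improve L F L = exchange e1 e2 F L"
      using improve_not_Nil by blast
    have "set (improve L F L) \<subseteq> set L"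
      using exchange_subset[of e1 e2 F L] e Cons.prems by auto
    with Cons.IH[of "improve L F L"] False e show ?thesis
      by (simp add: Let_def exchange_distinct exchange_conflict_free)
  qed (use Cons.prems in simp)
qed simp

text \<open>Every round gains at least one edge, so exhausted fuel means that \<open>F\<close> is
  already as long as \<open>L\<close>, and no duplicate-free list from \<open>L\<close> is
  longer.\<close>

lemma local_search_local_optimum:
  assumes "set F \<subseteq> set L" "distinct F" "conflict_free (set F)" "length L \<le> length F + length fuel"
  shows "local_optimum (set L) (set (local_search fuel F L))"
  using assms
proof (induction fuel arbitrary: F)
  case Nil
  have "length (exchange e1 e2 F L) \<le> length F" if "e1 \<in> set L" "e2 \<in> set L" for e1 e2
  proof -
    have "length (exchange e1 e2 F L) \<le> length L"
      using exchange_distinct[of e1 e2 F L] exchange_subset[of e1 e2 F L] that Nil.prems(1)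
      by (intro distinct_subset_length) auto
    with Nil show ?thesis by simp
  qed
  with Nil show ?case
    by (simp add: local_optimum_exchange)
next
  case (Cons a fuel)
  show ?case
  proof (cases "improve L F L = []")
    case True
    with Cons.prems show ?thesis
      using improve_Nil[OF True] by (simp add: local_optimum_exchange)
  next
    case False
    then obtain e1 e2 where e: "e1 \<in> set L" "e2 \<in> set L" "improve L F L = exchange e1 e2 F L"
      "length F < length (exchange e1 e2 F L)"
      using improve_not_Nil by blast
    have "set (improve L F L) \<subseteq> set L"
      using exchange_subset[of e1 e2 F L] e Cons.prems by auto
    with Cons.IH[of "improve L F L"] Cons.prems False e show ?thesis
      by (simp add: Let_def exchange_distinct exchange_conflict_free)
  qed
qed

section \<open>The search tree\<close>

definition consistent :: "('v \<times> 'c) list \<Rightarrow> ('v, 'c) cedge \<Rightarrow> bool" where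
  "consistent \<phi> e \<longleftrightarrow> (\<forall>(x, c)\<in>set \<phi>. x \<in> ends e \<longrightarrow> snd e = c)"

definition touches :: "('v \<times> 'c) list \<Rightarrow> ('v, 'c) cedge \<Rightarrow> bool" where
  "touches \<phi> e \<longleftrightarrow> (\<exists>(x, c)\<in>set \<phi>. x \<in> ends e)"

fun endpoints :: "('v, 'c) cedge list \<Rightarrow> 'v list \<Rightarrow> 'v list" where
  "endpoints [] xs = xs"
| "endpoints (e # es) xs = fst (fst e) # snd (fst e) # endpoints es xs"

lemma length_endpoints [simp]: "length (endpoints es xs) = 2 * length es + length xs"
  by (induction es) auto

lemma set_endpoints [simp]: "set (endpoints es xs) = (\<Union>e\<in>set es. ends e) \<union> set xs"
proof (induction es)
  case (Cons e es)
  then show ?case by (cases e; cases "fst e") auto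
qed simp

fun branch :: "'c list \<Rightarrow> (('v \<times> 'c) list \<Rightarrow> bool) \<Rightarrow> 'v list \<Rightarrow> ('v \<times> 'c) list \<Rightarrow> bool" where
  "branch cs S [] \<phi> = S \<phi>"
| "branch cs S (x # xs) \<phi> = (\<exists>c\<in>set cs. branch cs S xs ((x, c) # \<phi>))"

lemma branch_sound: "branch cs S xs \<phi> \<Longrightarrow> \<exists>\<psi>. S \<psi>"
  by (induction xs arbitrary: \<phi>) auto

lemma branch_complete:
  "(\<And>x. x \<in> set xs \<Longrightarrow> f x \<in> set cs) \<Longrightarrow> S (rev (map (\<lambda>x. (x, f x)) xs) @ \<phi>) \<Longrightarrow> branch cs S xs \<phi>"
  by (induction xs arbitrary: \<phi>) auto

text \<open>The condition \<open>induced\<close> expresses an induced matching at once: taking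
  \<open>e\<close> from \<open>ms\<close> makes the pairs disjoint, and taking any other
  \<open>e\<close> says that no edge joins two pairs.\<close>

locale clustering =
  fixes es ms :: "('v, 'c) cedge list" and cs :: "'c list" and k :: nat
  assumes distinct_es: "distinct es" and distinct_ms: "distinct ms"
    and ms_subset: "set ms \<subseteq> set es"
    and induced: "\<And>e p q. e \<in> set es \<Longrightarrow> p \<in> set ms \<Longrightarrow> q \<in> set ms \<Longrightarrow>
      ends e \<inter> ends p \<noteq> {} \<Longrightarrow> ends e \<inter> ends q \<noteq> {} \<Longrightarrow> p = q"
begin

text \<open>Stages count down, so \<open>0\<close> is the last one. There, edges without a coloured
  end are dropped unless they are pairs, which cuts the uncoloured part into single pairs and
  vertices.\<close>

definition stage_edges :: "nat \<Rightarrow> ('v \<times> 'c) list \<Rightarrow> ('v, 'c) cedge list" where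
  "stage_edges j \<phi> =
     filter (\<lambda>e. consistent \<phi> e \<and> (j \<noteq> 0 \<or> touches \<phi> e \<or> e \<in> set ms)) es"

definition start :: "nat \<Rightarrow> ('v \<times> 'c) list \<Rightarrow> ('v, 'c) cedge list" where
  "start j \<phi> = extend (extend [] (filter (consistent \<phi>) ms)) (stage_edges j \<phi>)"

definition solution :: "nat \<Rightarrow> ('v \<times> 'c) list \<Rightarrow> ('v, 'c) cedge list" where
  "solution j \<phi> = local_search (stage_edges j \<phi>) (start j \<phi>) (stage_edges j \<phi>)"

definition surplus :: "('v, 'c) cedge list \<Rightarrow> ('v, 'c) cedge list" where
  "surplus F = filter (\<lambda>e. e \<notin> set ms) F"

definition disturbed :: "('v, 'c) cedge list \<Rightarrow> ('v, 'c) cedge list" where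
  "disturbed F =
     filter (\<lambda>p. p \<notin> set F \<or> (\<exists>e\<in>set (surplus F). ends p \<inter> ends e \<noteq> {})) ms"

definition critical :: "('v, 'c) cedge list \<Rightarrow> 'v list" where
  "critical F = endpoints (surplus F) (endpoints (disturbed F) [])"

text \<open>The test against \<open>k\<close> before branching is what makes the branching
  affordable: only solutions with fewer than \<open>k\<close> edges have a critical set bounded in
  terms of \<open>d\<close>.\<close>

fun search :: "nat \<Rightarrow> ('v \<times> 'c) list \<Rightarrow> bool" where
  "search 0 \<phi> \<longleftrightarrow> k \<le> length (solution 0 \<phi>)"
| "search (Suc j) \<phi> \<longleftrightarrow> k \<le> length (solution (Suc j) \<phi>) \<or>
     branch cs (search j) (critical (solution (Suc j) \<phi>)) \<phi>"

lemma ms_disjoint: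
  "p \<in> set ms \<Longrightarrow> q \<in> set ms \<Longrightarrow> ends p \<inter> ends q \<noteq> {} \<Longrightarrow> p = q"
  using induced[of p p q] ms_subset by auto

lemma conflict_free_ms: "conflict_free (set ms)"
  using ms_disjoint unfolding conflict_free_def conflict_def by metis

text \<open>The pairs are disjoint, so each can be represented by a vertex of \<open>A\<close> of
  its own.\<close>

lemma card_ms_touching:
  assumes "finite A"
  shows "card {p\<in>set ms. ends p \<inter> A \<noteq> {}} \<le> card A"
proof -
  define g where "g p = (SOME x. x \<in> ends p \<inter> A)" for p :: "('v, 'c) cedge"
  have g: "g p \<in> ends p \<inter> A" if "ends p \<inter> A \<noteq> {}" for p
    unfolding g_def using that by (metis (no_types, lifting) ex_in_conv someI_ex)
  have "inj_on g {p\<in>set ms. ends p \<inter> A \<noteq> {}}"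
  proof (rule inj_onI)
    fix p q assume pq: "p \<in> {p\<in>set ms. ends p \<inter> A \<noteq> {}}" "q \<in> {p\<in>set ms. ends p \<inter> A \<noteq> {}}" "g p = g q"
    have "g p \<in> ends p" "g q \<in> ends q" using g[of p] g[of q] pq(1,2) by blast+
    then have "g p \<in> ends p \<inter> ends q" using pq(3) by simp
    with pq show "p = q" using ms_disjoint by blast
  qed
  moreover have "g ` {p\<in>set ms. ends p \<inter> A \<noteq> {}} \<subseteq> A" using g by auto
  ultimately show ?thesis using assms card_inj_on_le by blast
qed

lemma set_stage_edges_subset: "set (stage_edges j \<phi>) \<subseteq> set es"
  by (auto simp: stage_edges_def)

lemma start_superset: "set (filter (consistent \<phi>) ms) \<subseteq> set (start j \<phi>)"
proof
  fix p assume p: "p \<in> set (filter (consistent \<phi>) ms)"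
  have "p \<in> set (extend [] (filter (consistent \<phi>) ms))"
    using extend_subset[of "[]" "filter (consistent \<phi>) ms"] conflict_free_ms p
    by (intro extend_mem[OF p]) (auto simp: conflict_free_def)
  then show "p \<in> set (start j \<phi>)"
    unfolding start_def using extend_superset by blast
qed

lemma start_props:
  "set (start j \<phi>) \<subseteq> set (stage_edges j \<phi>)" "distinct (start j \<phi>)" "conflict_free (set (start j \<phi>))"
proof -
  have "set (filter (consistent \<phi>) ms) \<subseteq> set (stage_edges j \<phi>)"
    unfolding stage_edges_def set_filter using ms_subset by blast
  then show "set (start j \<phi>) \<subseteq> set (stage_edges j \<phi>)"
    unfolding start_def
    using extend_subset[of "extend [] (filter (consistent \<phi>) ms)" "stage_edges j \<phi>"]
      extend_subset[of "[]" "filter (consistent \<phi>) ms"]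
    by (simp del: set_filter) blast
  show "distinct (start j \<phi>)"
    unfolding start_def by (intro extend_distinct) simp
  show "conflict_free (set (start j \<phi>))"
    unfolding start_def by (intro extend_conflict_free) (simp add: conflict_free_def)
qed

lemma solution_props:
  "set (solution j \<phi>) \<subseteq> set (stage_edges j \<phi>)" "distinct (solution j \<phi>)"
  "conflict_free (set (solution j \<phi>))"
  using local_search_basic[OF start_props, of "stage_edges j \<phi>" j \<phi>] unfolding solution_def
  by simp_all

lemma solution_local_optimum: "local_optimum (set (stage_edges j \<phi>)) (set (solution j \<phi>))"
  unfolding solution_def by (intro local_search_local_optimum start_props) simp

lemma solution_witness:
  assumes "k \<le> length (solution j \<phi>)"
  shows "\<exists>F. F \<subseteq> set es \<and> conflict_free F \<and> k \<le> card F"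
proof (intro exI conjI)
  show "set (solution j \<phi>) \<subseteq> set es"
    by (rule order_trans[OF solution_props(1) set_stage_edges_subset])
  show "conflict_free (set (solution j \<phi>))"
    by (rule solution_props)
  show "k \<le> card (set (solution j \<phi>))"
    using assms by (simp add: distinct_card solution_props)
qed

text \<open>Each stage produces a conflict-free subset of \<open>es\<close> whatever colours were
  guessed, so a wrong guess cannot cause a false acceptance.\<close>

lemma search_sound:
  "search j \<phi> \<Longrightarrow> \<exists>F. F \<subseteq> set es \<and> conflict_free F \<and> k \<le> card F"
proof (induction j arbitrary: \<phi>)
  case 0
  then show ?case
    using solution_witness by simp
next
  case (Suc j)
  then consider "k \<le> length (solution (Suc j) \<phi>)" | \<psi> where "search j \<psi>"
    unfolding search.simps using branch_sound[of cs "search j"] by blast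
  then show ?case
  proof cases
    case 1
    then show ?thesis by (rule solution_witness)
  qed (rule Suc.IH)
qed

section \<open>The number of critical vertices\<close>

lemma exchange_keeps_ms:
  assumes "conflict_free (set F)"
  shows "card (set ms - set (exchange e1 e2 F L)) \<le> card (set ms - set F) + 4"
proof -
  \<comment> \<open>A pair that avoids the at most four ends of the seeds conflicts with neither of
    them and is retained.\<close>
  let ?A = "ends e1 \<union> ends e2"
  have "set ms - set (exchange e1 e2 F L) \<subseteq> (set ms - set F) \<union> {p\<in>set ms. ends p \<inter> ?A \<noteq> {}}"
    using exchange_retains[OF assms, of _ e1 e2 L] unfolding conflict_def by blast
  then have "card (set ms - set (exchange e1 e2 F L))
      \<le> card ((set ms - set F) \<union> {p\<in>set ms. ends p \<inter> ?A \<noteq> {}})"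
    by (intro card_mono) auto
  also have "\<dots> \<le> card (set ms - set F) + card {p\<in>set ms. ends p \<inter> ?A \<noteq> {}}"
    by (rule card_Un_le)
  also have "card {p\<in>set ms. ends p \<inter> ?A \<noteq> {}} \<le> card ?A"
    by (rule card_ms_touching) simp
  also have "card ?A \<le> 4"
    using card_Un_le[of "ends e1" "ends e2"] card_ends_le[of e1] card_ends_le[of e2] by simp
  finally show ?thesis by simp
qed

text \<open>An amortised count: a round loses at most four pairs and gains at least one edge. The
  additive form avoids truncated subtraction.\<close>

lemma local_search_keeps_ms:
  assumes "conflict_free (set F)"
  shows "card (set ms - set (local_search fuel F L)) + 4 * length F
    \<le> card (set ms - set F) + 4 * length (local_search fuel F L)"
  using assms
proof (induction fuel arbitrary: F)
  case (Cons a fuel)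
  show ?case
  proof (cases "improve L F L = []")
    case False
    then obtain e1 e2 where e: "improve L F L = exchange e1 e2 F L"
      "length F < length (exchange e1 e2 F L)"
      using improve_not_Nil by blast
    then show ?thesis
      using Cons.IH[of "improve L F L"] False exchange_keeps_ms[OF Cons.prems, of e1 e2 L]
      by (simp add: Let_def exchange_conflict_free)
  qed simp
qed simp

lemma card_diff_plus:
  assumes "finite A" "finite B"
  shows "card (A - B) + card B = card (B - A) + card A"
proof -
  have "card (A - B) + card B = card (A \<union> B)"
    using assms by (metis Un_Diff_cancel2 card_Un_disjoint Diff_disjoint finite_Diff inf_commute)
  moreover have "card (B - A) + card A = card (B \<union> A)"
    using assms by (metis Un_Diff_cancel2 card_Un_disjoint Diff_disjoint finite_Diff inf_commute)
  ultimately show ?thesis by (simp add: Un_commute)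
qed

text \<open>Consistent pairs enter the start first, so a missing pair is inconsistent and contains a
  coloured vertex.\<close>

lemma card_ms_not_start: "card (set ms - set (start j \<phi>)) \<le> length \<phi>"
proof -
  let ?A = "fst ` set \<phi>"
  have "set ms - set (start j \<phi>) \<subseteq> {p\<in>set ms. ends p \<inter> ?A \<noteq> {}}"
  proof
    fix p assume p: "p \<in> set ms - set (start j \<phi>)"
    then have "\<not> consistent \<phi> p" using start_superset[of \<phi> j] by auto
    then show "p \<in> {p\<in>set ms. ends p \<inter> ?A \<noteq> {}}"
      using p unfolding consistent_def by force
  qed
  then have "card (set ms - set (start j \<phi>)) \<le> card {p\<in>set ms. ends p \<inter> ?A \<noteq> {}}"
    by (intro card_mono) auto
  also have "\<dots> \<le> card ?A"
    by (rule card_ms_touching) simp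
  also have "\<dots> \<le> length \<phi>"
    by (meson List.finite_set card_image_le card_length order_trans)
  finally show ?thesis .
qed

text \<open>Let \<open>n = length \<phi>\<close>, and let the integer \<open>\<delta>\<close> be the
  size of the solution minus that of \<open>ms\<close>. The start misses at most \<open>n\<close>
  pairs, so the amortised count bounds the lost pairs by \<open>5 n + 4 \<delta>\<close>, and the
  surplus edges, which exceed the lost pairs by exactly \<open>\<delta>\<close>, by
  \<open>5 n + 5 \<delta>\<close>. A disturbed pair is lost or meets a surplus edge, at most two
  pairs for each such edge. Two ends for every surplus edge and every disturbed pair make at most
  \<open>6 * surplus + 2 * lost\<close>, that is \<open>40 n + 38 \<delta>\<close>, and
  \<open>\<delta>\<close> is below \<open>k\<close> minus the number of pairs.\<close>

lemma length_critical:
  assumes "length (solution j \<phi>) < k"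
  shows "length (critical (solution j \<phi>)) \<le> 40 * length \<phi> + 38 * (k - length ms)"
proof -
  let ?F = "solution j \<phi>" and ?S = "start j \<phi>"
  let ?D = "set (surplus ?F)" and ?m = "card (set ms)"
  let ?U = "\<Union>e\<in>?D. ends e"
  have F: "length ?F = card (set ?F)" and S: "length ?S = card (set ?S)"
    and m: "length ms = ?m"
    using distinct_card[OF solution_props(2)] distinct_card[OF start_props(2)]
      distinct_card[OF distinct_ms] by simp_all
  have 1: "card (set ms - set ?F) + 4 * card (set ?S) \<le> card (set ms - set ?S) + 4 * card (set ?F)"
    using local_search_keeps_ms[OF start_props(3)[of j \<phi>], of "stage_edges j \<phi>" "stage_edges j \<phi>"]
    unfolding solution_def[symmetric] F S .
  have 2: "card (set ms - set ?S) + card (set ?S) \<ge> ?m"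
    by (simp add: card_diff_plus)
  have 3: "card (set ms - set ?S) \<le> length \<phi>"
    by (rule card_ms_not_start)
  have D: "?D = set ?F - set ms"
    unfolding surplus_def set_filter by blast
  have 4: "card ?D + ?m = card (set ms - set ?F) + card (set ?F)"
    unfolding D by (simp add: card_diff_plus)
  have lD: "length (surplus ?F) = card ?D"
    unfolding surplus_def by (intro distinct_card[symmetric] distinct_filter solution_props)
  have "card ?U \<le> (\<Sum>e\<in>?D. card (ends e))"
    by (rule card_UN_le) simp
  also have "\<dots> \<le> (\<Sum>e\<in>?D. 2)"
    by (intro sum_mono card_ends_le)
  finally have 5: "card ?U \<le> 2 * card ?D" by simp
  have "set (disturbed ?F) \<subseteq> (set ms - set ?F) \<union> {p\<in>set ms. ends p \<inter> ?U \<noteq> {}}"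
    unfolding disturbed_def set_filter by blast
  then have "card (set (disturbed ?F)) \<le> card ((set ms - set ?F) \<union> {p\<in>set ms. ends p \<inter> ?U \<noteq> {}})"
    by (intro card_mono) auto
  also have "\<dots> \<le> card (set ms - set ?F) + card {p\<in>set ms. ends p \<inter> ?U \<noteq> {}}"
    by (rule card_Un_le)
  also have "card {p\<in>set ms. ends p \<inter> ?U \<noteq> {}} \<le> card ?U"
    by (rule card_ms_touching) simp
  finally have 6: "card (set (disturbed ?F)) \<le> card (set ms - set ?F) + 2 * card ?D"
    using 5 by simp
  have lM: "length (disturbed ?F) = card (set (disturbed ?F))"
    unfolding disturbed_def by (intro distinct_card[symmetric] distinct_filter distinct_ms)
  have "length (critical ?F) = 2 * card ?D + 2 * card (set (disturbed ?F))"
    by (simp add: critical_def lD lM)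
  then show ?thesis
    using 1 2 3 4 6 assms unfolding F m by linarith
qed

text \<open>This bound does not mention \<open>k\<close>. It keeps the partial colourings
  polynomially long, and with them the cost of a single node of the search tree.\<close>

lemma length_critical_le:
  "length (critical (solution j \<phi>)) \<le> 4 * length es"
proof -
  have "length (solution j \<phi>) \<le> length es"
    using order_trans[OF solution_props(1) set_stage_edges_subset]
    by (rule distinct_subset_length[OF solution_props(2)])
  then have "length (surplus (solution j \<phi>)) \<le> length es"
    unfolding surplus_def using length_filter_le order_trans by blast
  moreover have "length (disturbed (solution j \<phi>)) \<le> length es"
    unfolding disturbed_def
    using length_filter_le distinct_subset_length[OF distinct_ms ms_subset] order_trans by blast
  ultimately show ?thesis by (simp add: critical_def)
qed

section \<open>The solution away from the critical vertices\<close>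

lemma surplus_critical: "e \<in> set F \<Longrightarrow> e \<notin> set ms \<Longrightarrow> ends e \<subseteq> set (critical F)"
  unfolding critical_def surplus_def set_endpoints set_filter by blast

lemma missing_critical: "p \<in> set ms \<Longrightarrow> p \<notin> set F \<Longrightarrow> ends p \<subseteq> set (critical F)"
  unfolding critical_def disturbed_def set_endpoints set_filter by blast

text \<open>A pair that meets a surplus edge is disturbed, and one that meets a disturbed pair is
  that pair. Hence colouring critical vertices never splits a pair.\<close>

lemma critical_closed:
  assumes "p \<in> set ms" "ends p \<inter> set (critical F) \<noteq> {}"
  shows "ends p \<subseteq> set (critical F)"
proof -
  obtain x where x: "x \<in> ends p" "x \<in> set (critical F)"
    using assms(2) by blast
  then consider e where "e \<in> set (surplus F)" "x \<in> ends e" | q where "q \<in> set (disturbed F)" "x \<in> ends q"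
    unfolding critical_def set_endpoints by auto
  then have "p \<in> set (disturbed F)"
  proof cases
    case (1 e)
    then have "ends p \<inter> ends e \<noteq> {}" using x by blast
    with 1 show ?thesis unfolding disturbed_def set_filter using assms(1) by blast
  next
    case (2 q)
    then have "q \<in> set ms" unfolding disturbed_def by simp
    moreover have "ends p \<inter> ends q \<noteq> {}" using 2 x by blast
    ultimately have "p = q" by (rule ms_disjoint[OF assms(1)])
    with 2 show ?thesis by simp
  qed
  then show ?thesis unfolding critical_def set_endpoints by blast
qed

text \<open>Edges of one stage thus never conflict at a coloured vertex; the exchange arguments need
  to look at uncoloured vertices only.\<close>

lemma stage_edges_consistent:
  assumes "e \<in> set (stage_edges j \<phi>)" "g \<in> set (stage_edges j \<phi>)"
    and "x \<in> fst ` set \<phi>" "x \<in> ends e" "x \<in> ends g"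
  shows "snd e = snd g"
proof -
  obtain c where "(x, c) \<in> set \<phi>"
    using assms(3) by auto
  then have "snd e = c" "snd g = c"
    using assms unfolding stage_edges_def consistent_def by auto
  then show ?thesis by simp
qed

text \<open>Inserting two such edges would cost the solution only \<open>p\<close>: nothing
  conflicts at coloured vertices, and in \<open>p\<close> and \<open>W\<close> the solution has no
  edge except \<open>p\<close>, because surplus edges are critical and \<open>W\<close> avoids the
  pairs. The net gain of one edge contradicts local optimality.\<close>

lemma at_most_one_edge_at_pair:
  assumes p: "p \<in> set ms" "ends p \<inter> (fst ` set \<phi> \<union> set (critical (solution j \<phi>))) = {}"
    and W: "W \<inter> (fst ` set \<phi> \<union> set (critical (solution j \<phi>))) = {}" "W \<inter> (\<Union>q\<in>set ms. ends q) = {}"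
    and e1: "e1 \<in> set (stage_edges j \<phi>)" "ends e1 \<inter> ends p \<noteq> {}"
      "ends e1 \<subseteq> ends p \<union> fst ` set \<phi> \<union> W"
    and e2: "e2 \<in> set (stage_edges j \<phi>)" "ends e2 \<inter> ends p \<noteq> {}"
      "ends e2 \<subseteq> ends p \<union> fst ` set \<phi> \<union> W"
    and nc: "\<not> conflict e1 e2"
  shows "e1 = e2"
proof (rule ccontr)
  assume ne: "e1 \<noteq> e2"
  let ?F = "set (solution j \<phi>)" and ?L = "set (stage_edges j \<phi>)"
  let ?U = "fst ` set \<phi>" and ?X = "set (critical (solution j \<phi>))"
  have opt: "local_optimum ?L ?F" by (rule solution_local_optimum)
  have FL: "?F \<subseteq> ?L" by (rule solution_props)
  have only_p: "g = p" if "g \<in> ?F" "x \<in> ends g" "x \<in> ends p \<union> W" for g x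
  proof -
    have "x \<notin> ?X" using that(3) p(2) W(1) by blast
    then have g: "g \<in> set ms" using surplus_critical[OF that(1)] that(2) by blast
    then have "x \<in> ends p" using that(2,3) W(2) by blast
    then have "ends g \<inter> ends p \<noteq> {}" using that(2) by blast
    then show ?thesis by (rule ms_disjoint[OF g p(1)])
  qed
  have keep: "g = p" if g: "g \<in> ?F" and c: "conflict e g"
    and e: "e \<in> ?L" "ends e \<subseteq> ends p \<union> ?U \<union> W" for e g
  proof -
    obtain x where x: "x \<in> ends e" "x \<in> ends g" and ce: "snd e \<noteq> snd g"
      using c unfolding conflict_def by blast
    have "x \<notin> ?U"
      using stage_edges_consistent[OF e(1) subsetD[OF FL g], of x] x ce by blast
    then show ?thesis using only_p[OF g x(2)] e(2) x(1) by blast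
  qed
  have "p \<in> ?F"
    using missing_critical[OF p(1)] p(2) ends_nonempty[of p] by blast
  let ?G = "{f\<in>?F. \<not> conflict e1 f \<and> \<not> conflict e2 f}"
  have "?F - {p} \<subseteq> ?G"
    using keep e1(1,3) e2(1,3) by blast
  moreover have "e1 \<notin> ?F - {p}" "e2 \<notin> ?F - {p}"
    using only_p e1(2) e2(2) by blast+
  moreover have "card ({e1, e2} \<union> ?G) \<le> card ?F"
    using local_optimumD[OF opt e1(1) e2(1) _ nc, of "{e1, e2}"] e1(1) e2(1) by blast
  moreover have "card ({e1, e2} \<union> (?F - {p})) = Suc (card ?F)"
  proof -
    have "card ({e1, e2} \<union> (?F - {p})) = card {e1, e2} + card (?F - {p})"
      using \<open>e1 \<notin> ?F - {p}\<close> \<open>e2 \<notin> ?F - {p}\<close> by (intro card_Un_disjoint) auto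
    moreover have "card ?F > 0"
      using \<open>p \<in> ?F\<close> by (auto simp: card_gt_0_iff)
    ultimately show ?thesis
      using ne \<open>p \<in> ?F\<close> by simp
  qed
  moreover have "card ({e1, e2} \<union> (?F - {p})) \<le> card ({e1, e2} \<union> ?G)"
    using \<open>?F - {p} \<subseteq> ?G\<close> by (intro card_mono) auto
  ultimately show False by linarith
qed

text \<open>Such an edge would be disjoint from the whole solution, and maximality would add it.
  This is the independence of \<open>W1\<close>; the stage is positive so that no edge has been
  dropped.\<close>

lemma edge_leaves_uncovered:
  assumes "e \<in> set es" "ends e \<inter> set (critical (solution (Suc j) [])) = {}"
  shows "ends e \<inter> (\<Union>q\<in>set ms. ends q) \<noteq> {}"
proof
  let ?F = "solution (Suc j) []"
  assume no: "ends e \<inter> (\<Union>q\<in>set ms. ends q) = {}"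
  have L: "e \<in> set (stage_edges (Suc j) [])"
    using assms(1) by (simp add: stage_edges_def consistent_def)
  have disj: "ends e \<inter> ends f = {}" if "f \<in> set ?F" for f
    using surplus_critical[OF that] assms(2) no by blast
  have "e \<in> set ?F"
    using local_optimum_maximal[OF solution_local_optimum L] disj unfolding conflict_def by blast
  then show False using disj[of e] by simp
qed

text \<open>To be used with \<open>K\<close> a pair or a single vertex. Since \<open>S\<close>
  leaves \<open>K\<close> only towards coloured vertices, it conflicts with no solution edge that
  avoids \<open>K\<close>; so it can replace all solution edges at \<open>K\<close>, and optimality
  compares the two numbers.\<close>

lemma final_exchange:
  fixes \<phi> :: "('v \<times> 'c) list" and j :: nat
  defines "L \<equiv> set (stage_edges j \<phi>)" and "U \<equiv> fst ` set \<phi>"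
  assumes S: "S \<subseteq> L" "\<And>s. s \<in> S \<Longrightarrow> ends s \<inter> K \<noteq> {} \<and> ends s \<subseteq> K \<union> U"
    and e: "e1 \<in> S" "e2 \<in> S" "\<not> conflict e1 e2"
    and forced: "\<And>s g. s \<in> S \<Longrightarrow> g \<in> L \<Longrightarrow> conflict s g \<Longrightarrow> conflict e1 g \<or> conflict e2 g"
  shows "card S \<le> card {g\<in>set (solution j \<phi>). ends g \<inter> K \<noteq> {}}"
proof -
  let ?F = "set (solution j \<phi>)"
  let ?G = "{f\<in>?F. \<not> conflict e1 f \<and> \<not> conflict e2 f}" and ?C = "{g\<in>?F. ends g \<inter> K \<noteq> {}}"
  have opt: "local_optimum L ?F" unfolding L_def by (rule solution_local_optimum)
  have FL: "?F \<subseteq> L" unfolding L_def by (rule solution_props)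
  have nc: "\<not> conflict s g" if s: "s \<in> S" and g: "g \<in> ?F" "ends g \<inter> K = {}" for s g
  proof
    assume c: "conflict s g"
    then obtain x where x: "x \<in> ends s" "x \<in> ends g" "snd s \<noteq> snd g"
      unfolding conflict_def by blast
    then have "x \<in> U" using S(2)[OF s] g(2) by blast
    then show False
      using stage_edges_consistent[of s j \<phi> g x] x s g(1) S(1) FL unfolding L_def U_def by blast
  qed
  have "?F - ?C \<subseteq> ?G" using nc[OF e(1)] nc[OF e(2)] by blast
  have "S \<inter> (?F - ?C) = {}" using S(2) by blast
  moreover have "finite S" using S(1) unfolding L_def using finite_subset by blast
  ultimately have "card S + card (?F - ?C) = card (S \<union> (?F - ?C))"
    by (intro card_Un_disjoint[symmetric]) auto
  also have "\<dots> \<le> card (S \<union> ?G)"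
    using \<open>?F - ?C \<subseteq> ?G\<close> \<open>finite S\<close> by (intro card_mono) auto
  also have "\<dots> \<le> card ?F"
    using e(1,2) S(1) by (intro local_optimumD[OF opt _ _ S(1) e(3)] forced) auto
  also have "\<dots> = card ?C + card (?F - ?C)"
    using card_Un_disjoint[of ?C "?F - ?C"] by (simp add: Un_absorb1)
  finally show ?thesis by simp
qed

text \<open>The edges of \<open>Fs\<close> are covered by three kinds of places: the inside of
  \<open>U2\<close>, the remaining pairs, and the remaining single vertices. For \<open>Fs\<close>
  subadditivity over a cover is enough, so an edge between a pair and \<open>W2\<close> may simply
  be counted at its pair. For the solution the places are disjoint, since the last stage has no edge
  between two of them.\<close>

lemma solution_covers_optimum:
  fixes f :: "'v \<Rightarrow> 'c"
  assumes Fs: "Fs \<subseteq> set es" "\<And>e x. e \<in> Fs \<Longrightarrow> x \<in> ends e \<Longrightarrow> f x = snd e"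
    and \<phi>1: "fst ` set \<phi>1 = set (critical (solution 2 []))"
    and \<phi>2: "fst ` set \<phi>2 = set (critical (solution 1 \<phi>1)) \<union> fst ` set \<phi>1"
    and agrees: "\<And>x c. (x, c) \<in> set \<phi>1 \<union> set \<phi>2 \<Longrightarrow> c = f x"
  shows "card Fs \<le> length (solution 0 \<phi>2)"
proof -
  define U1 where "U1 = fst ` set \<phi>1"
  define U2 where "U2 = fst ` set \<phi>2"
  define PV where "PV = (\<Union>q\<in>set ms. ends q)"
  define L where "L = set (stage_edges 0 \<phi>2)"
  define F where "F = set (solution 0 \<phi>2)"
  define Q where "Q = {p\<in>set ms. ends p \<inter> U2 = {}}"
  have finFs: "finite Fs" using Fs(1) finite_subset by blast
  have nc: "\<not> conflict e g" if "e \<in> Fs" "g \<in> Fs" for e g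
    unfolding conflict_def using Fs(2)[OF that(1)] Fs(2)[OF that(2)] by (metis disjoint_iff)
  have U12: "U1 \<subseteq> U2" unfolding U1_def U2_def \<phi>2 by blast
  have touches_iff: "touches \<phi>2 e \<longleftrightarrow> ends e \<inter> U2 \<noteq> {}" for e
    unfolding touches_def U2_def by force
  have cons: "consistent \<phi>1 e" "consistent \<phi>2 e" if "e \<in> Fs" for e
    unfolding consistent_def using Fs(2)[OF that] agrees by fastforce+
  have FsL: "e \<in> L" if "e \<in> Fs" "ends e \<inter> U2 \<noteq> {}" for e
    unfolding L_def stage_edges_def using that cons Fs(1) touches_iff by auto
  have FL: "F \<subseteq> L" unfolding F_def L_def by (rule solution_props)
  have closed: "ends p \<subseteq> U2" if "p \<in> set ms" "p \<notin> Q" for p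
    using that critical_closed[of p "solution 2 []"] critical_closed[of p "solution 1 \<phi>1"]
    unfolding Q_def U2_def \<phi>2 \<phi>1 by blast
  have closed1: "ends p \<inter> U1 = {}" if "p \<in> Q" for p
    using that U12 unfolding Q_def by blast
  have L_pair: "ends g \<subseteq> ends p \<union> U2" if "g \<in> L" "p \<in> Q" "ends g \<inter> ends p \<noteq> {}" for g p
  proof -
    have "touches \<phi>2 g \<or> g \<in> set ms" using that(1) unfolding L_def stage_edges_def by simp
    then show ?thesis
    proof
      assume "touches \<phi>2 g"
      then show ?thesis
        using that(2,3) ends_subset_Un[of g "ends p" U2] unfolding touches_iff Q_def by blast
    next
      assume "g \<in> set ms"
      then have "g = p" using ms_disjoint[of g p] that(2,3) unfolding Q_def by blast
      then show ?thesis by blast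
    qed
  qed

  \<comment> \<open>Edges of the optimum at a remaining pair\<close>
  have pair: "card {e\<in>Fs. ends e \<inter> ends p \<noteq> {}} \<le> card {g\<in>F. ends g \<inter> ends p \<noteq> {}}"
    if p: "p \<in> Q" for p
  proof -
    let ?T = "{e\<in>Fs. ends e \<inter> ends p \<noteq> {}}"
    have pm: "p \<in> set ms" and pU2: "ends p \<inter> U2 = {}" using p unfolding Q_def by blast+
    have W: "ends e \<subseteq> ends p \<union> (- U1 - PV)" if e: "e \<in> ?T" "ends e \<inter> U1 = {}" for e
    proof
      fix y assume y: "y \<in> ends e"
      show "y \<in> ends p \<union> (- U1 - PV)"
      proof (cases "y \<in> PV")
        case True
        then obtain q where "q \<in> set ms" "y \<in> ends q" unfolding PV_def by blast
        then show ?thesis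
          using induced[of e p q] e(1) Fs(1) pm y by blast
      qed (use e(2) y in blast)
    qed
    have c2: "consistent [] e" for e :: "('v, 'c) cedge"
      unfolding consistent_def by simp
    \<comment> \<open>The first stage applies: nothing is coloured yet, its critical set is
      \<open>U1\<close>, and by \<open>W\<close> neither edge reaches another pair.\<close>
    have not_both_outside: "e1 = e2"
      if e: "e1 \<in> ?T" "e2 \<in> ?T" "ends e1 \<inter> U1 = {}" "ends e2 \<inter> U1 = {}" for e1 e2
    proof (rule at_most_one_edge_at_pair[of p "[]" 2 "- U1 - PV" e1 e2])
      show "\<not> conflict e1 e2"
        by (rule nc) (use e in blast)+
      show "ends p \<inter> (fst ` set [] \<union> set (critical (solution 2 []))) = {}"
        using closed1[OF p] unfolding U1_def \<phi>1 by simp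
    qed (use e W[OF e(1,3)] W[OF e(2,4)] Fs(1) pm c2 in
        \<open>auto simp: stage_edges_def U1_def \<phi>1 PV_def\<close>)
    \<comment> \<open>The second stage applies: \<open>U1\<close> is coloured, and edges of
      \<open>Fs\<close> pass the restriction because \<open>f\<close> agrees with
      \<open>\<phi>1\<close>.\<close>
    have not_both_coloured: "e1 = e2"
      if e: "e1 \<in> ?T" "e2 \<in> ?T" "ends e1 \<subseteq> ends p \<union> U1 \<union> (- U2 - PV)"
        "ends e2 \<subseteq> ends p \<union> U1 \<union> (- U2 - PV)" for e1 e2
    proof (rule at_most_one_edge_at_pair[of p \<phi>1 1 "- U2 - PV" e1 e2])
      show "\<not> conflict e1 e2"
        by (rule nc) (use e in blast)+
      show "ends p \<inter> (fst ` set \<phi>1 \<union> set (critical (solution 1 \<phi>1))) = {}"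
        using pU2 unfolding U2_def \<phi>2 by blast
      show "(- U2 - PV) \<inter> (fst ` set \<phi>1 \<union> set (critical (solution 1 \<phi>1))) = {}"
        unfolding U2_def \<phi>2 by blast
      show "(- U2 - PV) \<inter> (\<Union>q\<in>set ms. ends q) = {}"
        unfolding PV_def by blast
      show "e1 \<in> set (stage_edges 1 \<phi>1)" "e2 \<in> set (stage_edges 1 \<phi>1)"
        using e(1,2) cons Fs(1) unfolding stage_edges_def by auto
    qed (use e pm in \<open>auto simp: U1_def\<close>)
    have near: "ends e \<subseteq> ends p \<union> U1" if "e \<in> ?T" "ends e \<inter> U1 \<noteq> {}" for e
      using that closed1[OF p] ends_subset_Un[of e "ends p" U1] by blast
    \<comment> \<open>Two edges at \<open>p\<close> always differ in whether they meet
      \<open>U1\<close>, so there are at most two.\<close>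
    have types: "(ends e1 \<inter> U1 \<noteq> {}) \<noteq> (ends e2 \<inter> U1 \<noteq> {})"
      if "e1 \<in> ?T" "e2 \<in> ?T" "e1 \<noteq> e2" for e1 e2
      using not_both_outside[OF that(1,2)] not_both_coloured[OF that(1,2)] near that by blast
    show ?thesis
    proof (cases "\<exists>e1 e2. e1 \<in> ?T \<and> e2 \<in> ?T \<and> e1 \<noteq> e2")
      case True
      then obtain a b where ab: "a \<in> ?T" "b \<in> ?T" "a \<noteq> b" by blast
      obtain e1 e2 where e: "e1 \<in> ?T" "e2 \<in> ?T" "e1 \<noteq> e2"
        and U: "ends e1 \<inter> U1 \<noteq> {}" "ends e2 \<inter> U1 = {}"
      proof (cases "ends a \<inter> U1 = {}")
        case True
        then show thesis
          using types[OF ab] by (intro that[OF ab(2,1) ab(3)[symmetric]]) simp_all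
      next
        case False
        then show thesis
          using types[OF ab] by (intro that[OF ab]) simp_all
      qed
      have T: "?T = {e1, e2}"
      proof
        show "?T \<subseteq> {e1, e2}"
        proof
          fix e3 assume "e3 \<in> ?T"
          then show "e3 \<in> {e1, e2}"
            using types[of e3 e1] types[of e3 e2] types[of e1 e2] e by blast
        qed
      qed (use e in blast)
      have U2e: "ends e1 \<inter> U2 \<noteq> {}" "ends e2 \<inter> U2 \<noteq> {}"
      proof -
        show "ends e1 \<inter> U2 \<noteq> {}" using U(1) U12 by blast
        show "ends e2 \<inter> U2 \<noteq> {}"
        proof
          assume "ends e2 \<inter> U2 = {}"
          then have "ends e2 \<subseteq> ends p \<union> U1 \<union> (- U2 - PV)"
            using W[OF e(2) U(2)] by blast
          then have "e1 = e2"
            using near[OF e(1) U(1)] by (intro not_both_coloured[OF e(1,2)]) blast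
          with e(3) show False ..
        qed
      qed
      have "card {e1, e2} \<le> card {g\<in>set (solution 0 \<phi>2). ends g \<inter> ends p \<noteq> {}}"
      proof (rule final_exchange[of "{e1, e2}" 0 \<phi>2 "ends p" e1 e2])
        show "{e1, e2} \<subseteq> set (stage_edges 0 \<phi>2)"
          using FsL e U2e unfolding L_def by blast
        show "ends s \<inter> ends p \<noteq> {} \<and> ends s \<subseteq> ends p \<union> fst ` set \<phi>2" if "s \<in> {e1, e2}" for s
          using that e L_pair[OF _ p] FsL U2e unfolding U2_def by blast
        show "\<not> conflict e1 e2"
          by (rule nc) (use e in blast)+
      qed auto
      then show ?thesis unfolding T F_def .
    next
      case False
      show ?thesis
      proof (cases "?T = {}")
        case nonempty: False
        then obtain e where "e \<in> ?T" by blast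
        with False have "?T = {e}" by blast
        \<comment> \<open>The only edge at \<open>p\<close> may lead to \<open>W2\<close> and be
          absent from the last stage. The comparison uses \<open>p\<close> itself instead, which the
          last stage keeps because \<open>p\<close> has no coloured vertex.\<close>
        moreover have pL: "p \<in> L"
        proof -
          have "consistent \<phi>2 p"
            using pU2 unfolding consistent_def U2_def by force
          then show ?thesis
            using pm ms_subset unfolding L_def stage_edges_def by auto
        qed
        have "card {p} \<le> card {g\<in>set (solution 0 \<phi>2). ends g \<inter> ends p \<noteq> {}}"
          by (rule final_exchange[of "{p}" 0 \<phi>2 "ends p" p p]) (use pL in \<open>auto simp: L_def\<close>)
        ultimately show ?thesis unfolding F_def by simp
      next
        case True
        show ?thesis unfolding True card.empty by (rule le0)
      qed
    qed
  qed

  \<comment> \<open>Edges of the optimum at a remaining single vertex\<close>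
  have single: "card {e\<in>Fs. w \<in> ends e \<and> ends e \<subseteq> {w} \<union> U2} \<le> card {g\<in>F. ends g \<inter> {w} \<noteq> {}}"
    if w: "w \<notin> U2" "w \<notin> PV" for w
  proof -
    let ?T = "{e\<in>Fs. w \<in> ends e \<and> ends e \<subseteq> {w} \<union> U2}"
    show ?thesis
    proof (cases "?T = {}")
      case False
      then obtain e1 where e1: "e1 \<in> ?T" by blast
      have U2e: "ends e \<inter> U2 \<noteq> {}" if e: "e \<in> ?T" for e
      proof
        assume "ends e \<inter> U2 = {}"
        \<comment> \<open>The locale admits loops; a loop at \<open>w\<close> is ruled out like any
          other edge outside \<open>U2\<close> and the pairs.\<close>
        then have "ends e = {w}" using e by blast
        then have "ends e \<inter> set (critical (solution (Suc 1) [])) = {}" "ends e \<inter> PV = {}"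
          using w U12 unfolding U1_def \<phi>1 by (auto simp: numeral_2_eq_2)
        then show False
          using edge_leaves_uncovered[of e 1] e Fs(1) unfolding PV_def by blast
      qed
      have "card ?T \<le> card {g\<in>set (solution 0 \<phi>2). ends g \<inter> {w} \<noteq> {}}"
      \<comment> \<open>One seed, used twice, forces the star: an edge of the stage can conflict
        with the star only at \<open>w\<close>, where all edges of the star have the colour of
        \<open>e1\<close>.\<close>
      proof (rule final_exchange[of ?T 0 \<phi>2 "{w}" e1 e1])
        show TL: "?T \<subseteq> set (stage_edges 0 \<phi>2)"
          using FsL U2e unfolding L_def by blast
        show "ends s \<inter> {w} \<noteq> {} \<and> ends s \<subseteq> {w} \<union> fst ` set \<phi>2" if "s \<in> ?T" for s
          using that unfolding U2_def by blast
        show "conflict e1 g \<or> conflict e1 g"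
          if s: "s \<in> ?T" and g: "g \<in> set (stage_edges 0 \<phi>2)" and c: "conflict s g" for s g
        proof -
          obtain x where x: "x \<in> ends s" "x \<in> ends g" "snd s \<noteq> snd g"
            using c unfolding conflict_def by blast
          have "x \<notin> U2"
            using stage_edges_consistent[of s 0 \<phi>2 g x] x g TL s unfolding U2_def by blast
          then have "x = w" using x s by blast
          moreover have "snd s = snd e1" using Fs(2)[of s w] Fs(2)[of e1 w] s e1 by simp
          ultimately show ?thesis using x e1 unfolding conflict_def by auto
        qed
      qed (use e1 in auto)
      then show ?thesis unfolding F_def .
    next
      case True
      show ?thesis unfolding True card.empty by (rule le0)
    qed
  qed

  \<comment> \<open>Adding up the comparisons\<close>
  define A where "A = {e\<in>Fs. ends e \<subseteq> U2}"
  define W where "W = (\<Union>e\<in>Fs. ends e) - U2 - PV"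
  define Tp where "Tp p = {e\<in>Fs. ends e \<inter> ends p \<noteq> {}}" for p :: "('v, 'c) cedge"
  define Tw where "Tw w = {e\<in>Fs. w \<in> ends e \<and> ends e \<subseteq> {w} \<union> U2}" for w
  define Rp where "Rp p = {g\<in>F. ends g \<inter> ends p \<noteq> {}}" for p :: "('v, 'c) cedge"
  define Rw where "Rw w = {g\<in>F. ends g \<inter> {w} \<noteq> {}}" for w
  have finW: "finite W" unfolding W_def using finFs by simp
  have finQ: "finite Q" unfolding Q_def by simp
  have finF: "finite F" unfolding F_def by simp
  have cover: "Fs \<subseteq> A \<union> (\<Union>p\<in>Q. Tp p) \<union> (\<Union>w\<in>W. Tw w)"
  proof
    fix e assume e: "e \<in> Fs"
    show "e \<in> A \<union> (\<Union>p\<in>Q. Tp p) \<union> (\<Union>w\<in>W. Tw w)"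
    proof (cases "ends e \<subseteq> U2 \<or> (\<exists>p\<in>Q. ends e \<inter> ends p \<noteq> {})")
      case True
      then show ?thesis using e unfolding A_def Tp_def by blast
    next
      case False
      then have out: "ends e \<inter> PV \<subseteq> U2" using closed unfolding PV_def by blast
      obtain w where w: "w \<in> ends e" "w \<notin> U2" using False by blast
      then have wW: "w \<in> W" using out e unfolding W_def by blast
      have "ends e \<inter> U2 \<noteq> {}"
      proof
        assume "ends e \<inter> U2 = {}"
        then have "ends e \<inter> set (critical (solution (Suc 1) [])) = {}" "ends e \<inter> PV = {}"
          using out U12 unfolding U1_def \<phi>1 by (auto simp: numeral_2_eq_2)
        then show False
          using edge_leaves_uncovered[of e 1] e Fs(1) unfolding PV_def by blast
      qed
      then have "ends e \<subseteq> {w} \<union> U2"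
        using w by (intro ends_subset_Un) auto
      then show ?thesis using e w wW unfolding Tw_def by blast
    qed
  qed
  \<comment> \<open>All ends of such an edge are coloured, so nothing in the stage conflicts with it
    and maximality includes it.\<close>
  have AF: "A \<subseteq> F"
  proof
    fix e assume e: "e \<in> A"
    then have eL: "e \<in> L" using FsL[of e] ends_nonempty[of e] unfolding A_def by blast
    have "\<not> conflict e g" if "g \<in> F" for g
      using stage_edges_consistent[of e 0 \<phi>2 g] e eL that FL
      unfolding conflict_def L_def A_def U2_def by blast
    then show "e \<in> F"
      using local_optimum_maximal[OF solution_local_optimum eL[unfolded L_def]] unfolding F_def by blast
  qed
  have F_w: "ends g \<subseteq> {w} \<union> U2" if "g \<in> F" "w \<in> ends g" "w \<in> W" for g w
  proof -
    have "g \<notin> set ms" using that unfolding W_def PV_def by blast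
    then have "ends g \<inter> U2 \<noteq> {}" using that(1) FL touches_iff unfolding L_def stage_edges_def by auto
    then show ?thesis using that unfolding W_def by (intro ends_subset_Un) auto
  qed
  have F_p: "ends g \<subseteq> ends p \<union> U2" if "g \<in> Rp p" "p \<in> Q" for g p
    using that FL L_pair unfolding Rp_def by blast
  have W_p: "w \<notin> ends p" if "w \<in> W" "p \<in> Q" for w p
    using that unfolding W_def PV_def Q_def by blast
  have "card Fs \<le> card (A \<union> (\<Union>p\<in>Q. Tp p) \<union> (\<Union>w\<in>W. Tw w))"
    using cover finFs finQ finW unfolding A_def Tp_def Tw_def by (intro card_mono) auto
  also have "\<dots> \<le> card A + card (\<Union>p\<in>Q. Tp p) + card (\<Union>w\<in>W. Tw w)"
    by (meson add_le_mono card_Un_le le_refl order_trans)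
  also have "\<dots> \<le> card A + (\<Sum>p\<in>Q. card (Tp p)) + (\<Sum>w\<in>W. card (Tw w))"
    using card_UN_le[OF finQ, of Tp] card_UN_le[OF finW, of Tw] by linarith
  also have "\<dots> \<le> card A + (\<Sum>p\<in>Q. card (Rp p)) + (\<Sum>w\<in>W. card (Rw w))"
    using sum_mono[of Q "\<lambda>p. card (Tp p)" "\<lambda>p. card (Rp p)"]
      sum_mono[of W "\<lambda>w. card (Tw w)" "\<lambda>w. card (Rw w)"] pair single
    unfolding Tp_def Tw_def Rp_def Rw_def W_def by (meson DiffE add_mono le_refl)
  also have "(\<Sum>p\<in>Q. card (Rp p)) = card (\<Union>p\<in>Q. Rp p)"
  proof (rule card_UN_disjoint[symmetric, OF finQ])
    show "\<forall>p\<in>Q. finite (Rp p)" unfolding Rp_def using finF by simp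
    show "\<forall>p\<in>Q. \<forall>q\<in>Q. p \<noteq> q \<longrightarrow> Rp p \<inter> Rp q = {}"
      using induced FL set_stage_edges_subset unfolding Rp_def Q_def L_def by blast
  qed
  also have "(\<Sum>w\<in>W. card (Rw w)) = card (\<Union>w\<in>W. Rw w)"
  proof (rule card_UN_disjoint[symmetric, OF finW])
    show "\<forall>p\<in>W. finite (Rw p)" unfolding Rw_def using finF by simp
    show "\<forall>p\<in>W. \<forall>q\<in>W. p \<noteq> q \<longrightarrow> Rw p \<inter> Rw q = {}"
      using F_w unfolding Rw_def W_def by blast
  qed
  also have "card A + card (\<Union>p\<in>Q. Rp p) + card (\<Union>w\<in>W. Rw w)
      = card (A \<union> (\<Union>p\<in>Q. Rp p) \<union> (\<Union>w\<in>W. Rw w))"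
  proof -
    have fin: "finite A" "finite (\<Union>p\<in>Q. Rp p)" "finite (\<Union>w\<in>W. Rw w)"
      using finF finQ finW AF finite_subset unfolding Rp_def Rw_def by auto
    have "A \<inter> (\<Union>p\<in>Q. Rp p) = {}"
      unfolding A_def Rp_def Q_def by blast
    moreover have "(A \<union> (\<Union>p\<in>Q. Rp p)) \<inter> (\<Union>w\<in>W. Rw w) = {}"
    proof -
      have "w \<notin> ends g" if "w \<in> W" "g \<in> A" for w g
        using that unfolding A_def W_def by blast
      moreover have "w \<notin> ends g" if "w \<in> W" "p \<in> Q" "g \<in> Rp p" for w g p
        using F_p[OF that(3,2)] W_p[OF that(1,2)] that(1) unfolding W_def by blast
      ultimately show ?thesis unfolding Rw_def by blast
    qed
    ultimately show ?thesis using fin by (simp add: card_Un_disjoint)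
  qed
  also have "\<dots> \<le> card F"
    using AF finF unfolding Rp_def Rw_def by (intro card_mono) auto
  also have "\<dots> = length (solution 0 \<phi>2)"
    unfolding F_def by (intro distinct_card solution_props)
  finally show ?thesis .
qed

lemma search_complete:
  assumes F: "F \<subseteq> set es" "conflict_free F" "k \<le> card F"
    and colours: "snd ` set es \<subseteq> set cs"
  shows "search 2 []"
proof (cases "set es = {}")
  case True
  then have "k = 0" using F by simp
  then show ?thesis unfolding numeral_2_eq_2 search.simps by simp
next
  case False
  then obtain e0 where "e0 \<in> set es" by (meson ex_in_conv)
  then have c0: "snd e0 \<in> set cs" using colours imageI subsetD by metis
  \<comment> \<open>Vertices that \<open>F\<close> leaves free get the colour of an arbitrary edge
    \<open>e0\<close>, since every critical vertex must receive a colour from \<open>cs\<close>.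
    Hence the separate case without edges.\<close>
  define f where "f x = (if \<exists>e\<in>F. x \<in> ends e then snd (SOME e. e \<in> F \<and> x \<in> ends e) else snd e0)" for x
  have f: "f x = snd e" if e: "e \<in> F" "x \<in> ends e" for e x
  proof -
    define g where "g = (SOME e. e \<in> F \<and> x \<in> ends e)"
    have g: "g \<in> F" "x \<in> ends g"
      unfolding g_def using someI[of "\<lambda>e. e \<in> F \<and> x \<in> ends e" e] e by simp_all
    have "\<not> conflict g e"
      using F(2) g(1) e(1) unfolding conflict_free_def by simp
    then have "snd g = snd e"
      using g(2) e(2) unfolding conflict_def by blast
    moreover have "f x = snd g"
      unfolding f_def g_def using bexI[of "\<lambda>e. x \<in> ends e", OF e(2,1)] by (rule if_P)
    ultimately show ?thesis by simp
  qed
  have f_cs: "f x \<in> set cs" for x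
  proof (cases "\<exists>e\<in>F. x \<in> ends e")
    case True
    then obtain e where e: "e \<in> F" "x \<in> ends e" by blast
    then show ?thesis unfolding f[OF e] using F(1) colours by blast
  qed (simp add: f_def c0)
  \<comment> \<open>The reversal matches \<open>branch\<close>, which puts each newly coloured
    vertex in front.\<close>
  let ?col = "\<lambda>xs. rev (map (\<lambda>x. (x, f x)) xs)"
  define \<phi>1 where "\<phi>1 = ?col (critical (solution (Suc (Suc 0)) [])) @ []"
  define \<phi>2 where "\<phi>2 = ?col (critical (solution (Suc 0) \<phi>1)) @ \<phi>1"
  have "card F \<le> length (solution 0 \<phi>2)"
  proof (rule solution_covers_optimum[OF F(1) f])
    show "fst ` set \<phi>1 = set (critical (solution 2 []))"
      unfolding \<phi>1_def by (simp add: image_image numeral_2_eq_2)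
    show "fst ` set \<phi>2 = set (critical (solution 1 \<phi>1)) \<union> fst ` set \<phi>1"
      unfolding \<phi>2_def by (simp add: image_image image_Un)
    show "c = f x" if "(x, c) \<in> set \<phi>1 \<union> set \<phi>2" for x c
      using that unfolding \<phi>2_def \<phi>1_def by auto
  qed
  then have "search 0 \<phi>2"
    using F(3) by simp
  then have "search (Suc 0) \<phi>1"
    unfolding search.simps \<phi>2_def using f_cs by (intro disjI2 branch_complete) auto
  then have "search (Suc (Suc 0)) []"
    unfolding search.simps(2)[of "Suc 0"] \<phi>1_def using f_cs by (intro disjI2 branch_complete)
  then show ?thesis by (simp only: numeral_2_eq_2)
qed

end

section \<open>Symbolic evaluation of programs\<close>

text \<open>A weakest precondition whose continuation sees the value and the exact time. The
  equations that follow let the simplifier execute a function body.\<close>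

definition evals_with :: "program \<Rightarrow> data list \<Rightarrow> exp \<Rightarrow> (data \<Rightarrow> nat \<Rightarrow> bool) \<Rightarrow> bool" where
  "evals_with P env e Q \<longleftrightarrow> (\<exists>v t. evalto P env e v t \<and> Q v t)"

definition all_eval_with ::
  "program \<Rightarrow> data list \<Rightarrow> exp list \<Rightarrow> (data list \<Rightarrow> nat \<Rightarrow> bool) \<Rightarrow> bool" where
  "all_eval_with P env es Q \<longleftrightarrow> (\<exists>vs t. evalsto P env es vs t \<and> Q vs t)"

definition call_with :: "program \<Rightarrow> nat \<Rightarrow> data list \<Rightarrow> (data \<Rightarrow> nat \<Rightarrow> bool) \<Rightarrow> bool" where
  "call_with P f vs Q \<longleftrightarrow> f < length P \<and> evals_with P vs (P ! f) Q"

lemma evals_with_Var: "evals_with P env (Var i) Q \<longleftrightarrow> i < length env \<and> Q (env ! i) (Suc 0)" (is "?L \<longleftrightarrow> ?R")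
proof
  show ?R if ?L
    using that unfolding evals_with_def
    by (elim exE conjE, elim eval_VarE) simp
  show ?L if ?R
    using that unfolding evals_with_def
    by (blast intro: eval_Var[simplified])
qed

lemma evals_with_EAtom: "evals_with P env EAtom Q \<longleftrightarrow> Q Atom (Suc 0)" (is "?L \<longleftrightarrow> ?R")
proof
  show ?R if ?L
    using that unfolding evals_with_def
    by (elim exE conjE, elim eval_EAtomE) simp
  show ?L if ?R
    using that unfolding evals_with_def
    by (blast intro: eval_EAtom[simplified])
qed

lemma evals_with_EPair: "evals_with P env (EPair a b) Q \<longleftrightarrow>
    evals_with P env a (\<lambda>v t. evals_with P env b (\<lambda>w s. Q (Pair v w) (Suc (t + s))))" (is "?L \<longleftrightarrow> ?R")
proof
  show ?R if ?L
    using that unfolding evals_with_def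
    by (elim exE conjE, elim eval_EPairE) blast
  show ?L if ?R
    using that unfolding evals_with_def
    by (blast intro: eval_EPair[simplified])
qed

lemma evals_with_Fst: "evals_with P env (Fst e) Q \<longleftrightarrow> evals_with P env e (\<lambda>v t. Q (fst_data v) (Suc t))" (is "?L \<longleftrightarrow> ?R")
proof
  show ?R if ?L
    using that unfolding evals_with_def
    by (elim exE conjE, elim eval_FstE) blast
  show ?L if ?R
    using that unfolding evals_with_def
    by (blast intro: eval_Fst[simplified])
qed

lemma evals_with_Snd: "evals_with P env (Snd e) Q \<longleftrightarrow> evals_with P env e (\<lambda>v t. Q (snd_data v) (Suc t))" (is "?L \<longleftrightarrow> ?R")
proof
  show ?R if ?L
    using that unfolding evals_with_def
    by (elim exE conjE, elim eval_SndE) blast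
  show ?L if ?R
    using that unfolding evals_with_def
    by (blast intro: eval_Snd[simplified])
qed

lemma evals_with_IfPair: "evals_with P env (IfPair e a b) Q \<longleftrightarrow>
    evals_with P env e (\<lambda>v t. case v of
      Atom \<Rightarrow> evals_with P env b (\<lambda>w s. Q w (Suc (t + s)))
    | Pair _ _ \<Rightarrow> evals_with P env a (\<lambda>w s. Q w (Suc (t + s))))"
proof
  assume "evals_with P env (IfPair e a b) Q"
  then obtain v t where ev: "evalto P env (IfPair e a b) v t" and Q: "Q v t"
    unfolding evals_with_def by blast
  from ev show "evals_with P env e (\<lambda>v t. case v of
      Atom \<Rightarrow> evals_with P env b (\<lambda>w s. Q w (Suc (t + s)))
    | Pair _ _ \<Rightarrow> evals_with P env a (\<lambda>w s. Q w (Suc (t + s))))"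
  proof (rule eval_IfE)
    fix x y t0 t1
    assume "t = Suc (t0 + t1)" "evalto P env e (Pair x y) t0" "evalto P env a v t1"
    then show ?thesis
      unfolding evals_with_def using Q by (intro exI[of _ "Pair x y"] exI[of _ t0]) auto
  next
    fix t0 t1
    assume "t = Suc (t0 + t1)" "evalto P env e Atom t0" "evalto P env b v t1"
    then show ?thesis
      unfolding evals_with_def using Q by (intro exI[of _ Atom] exI[of _ t0]) auto
  qed
next
  assume "evals_with P env e (\<lambda>v t. case v of
      Atom \<Rightarrow> evals_with P env b (\<lambda>w s. Q w (Suc (t + s)))
    | Pair _ _ \<Rightarrow> evals_with P env a (\<lambda>w s. Q w (Suc (t + s))))"
  then obtain v t where e: "evalto P env e v t" and rest: "case v of
      Atom \<Rightarrow> evals_with P env b (\<lambda>w s. Q w (Suc (t + s)))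
    | Pair _ _ \<Rightarrow> evals_with P env a (\<lambda>w s. Q w (Suc (t + s)))"
    unfolding evals_with_def by blast
  show "evals_with P env (IfPair e a b) Q"
  proof (cases v)
    case Atom
    then obtain w s where "evalto P env b w s" "Q w (Suc (t + s))"
      using rest unfolding evals_with_def by auto
    then show ?thesis
      using eval_If_Atom[simplified, OF e[unfolded Atom]] unfolding evals_with_def by blast
  next
    case (Pair x y)
    then obtain w s where "evalto P env a w s" "Q w (Suc (t + s))"
      using rest unfolding evals_with_def by auto
    then show ?thesis
      using eval_If_Pair[simplified, OF e[unfolded Pair]] unfolding evals_with_def by blast
  qed
qed

lemma evals_with_LetIn: "evals_with P env (LetIn a b) Q \<longleftrightarrow>
    evals_with P env a (\<lambda>v t. evals_with P (v # env) b (\<lambda>w s. Q w (Suc (t + s))))" (is "?L \<longleftrightarrow> ?R")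
proof
  show ?R if ?L
    using that unfolding evals_with_def
    by (elim exE conjE, elim eval_LetInE) blast
  show ?L if ?R
    using that unfolding evals_with_def
    by (blast intro: eval_LetIn[simplified])
qed

lemma evals_with_Call: "evals_with P env (Call f es) Q \<longleftrightarrow>
    all_eval_with P env es (\<lambda>vs t. call_with P f vs (\<lambda>v s. Q v (Suc (t + s))))" (is "?L \<longleftrightarrow> ?R")
proof
  show ?R if ?L
    using that unfolding evals_with_def all_eval_with_def call_with_def
    by (elim exE conjE, elim eval_CallE) blast
  show ?L if ?R
    using that unfolding evals_with_def all_eval_with_def call_with_def
    by (blast intro: eval_Call[simplified])
qed

lemma all_eval_with_Nil: "all_eval_with P env [] Q \<longleftrightarrow> Q [] (Suc 0)" (is "?L \<longleftrightarrow> ?R")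
proof
  show ?R if ?L
    using that unfolding all_eval_with_def
    by (elim exE conjE, elim evals_NilE) simp
  show ?L if ?R
    using that unfolding all_eval_with_def
    by (blast intro: evals_Nil[simplified])
qed

lemma all_eval_with_Cons: "all_eval_with P env (e # es) Q \<longleftrightarrow>
    evals_with P env e (\<lambda>v t. all_eval_with P env es (\<lambda>vs s. Q (v # vs) (Suc (t + s))))" (is "?L \<longleftrightarrow> ?R")
proof
  show ?R if ?L
    using that unfolding evals_with_def all_eval_with_def
    by (elim exE conjE, elim evals_ConsE) blast
  show ?L if ?R
    using that unfolding evals_with_def all_eval_with_def
    by (blast intro: evals_Cons[simplified])
qed

lemmas evals_with_simps = evals_with_Var evals_with_EAtom evals_with_EPair evals_with_Fst
  evals_with_Snd evals_with_IfPair evals_with_LetIn evals_with_Call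
  all_eval_with_Nil all_eval_with_Cons

definition computes :: "program \<Rightarrow> nat \<Rightarrow> data list \<Rightarrow> data \<Rightarrow> nat \<Rightarrow> bool" where
  "computes P f vs v B \<longleftrightarrow> call_with P f vs (\<lambda>w t. w = v \<and> t \<le> B)"

text \<open>Naming the exact time of a call makes the call a rewrite rule; its bound is then
  supplied separately as an inequality for linear arithmetic.\<close>

definition run_time :: "program \<Rightarrow> nat \<Rightarrow> data list \<Rightarrow> nat" where
  "run_time P f vs = (THE t. \<exists>v. evalto P vs (P ! f) v t)"

lemma computesE:
  assumes "computes P f vs v B"
  shows "f < length P" "evalto P vs (P ! f) v (run_time P f vs)" "run_time P f vs \<le> B"
proof -
  obtain t where t: "f < length P" "evalto P vs (P ! f) v t" "t \<le> B"
    using assms unfolding computes_def call_with_def evals_with_def by blast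
  moreover have "run_time P f vs = t"
    unfolding run_time_def using t(2) evalto_deterministic(1)[OF t(2)] by blast
  ultimately show "f < length P" "evalto P vs (P ! f) v (run_time P f vs)" "run_time P f vs \<le> B"
    by simp_all
qed

lemma call_with_eq:
  assumes "computes P f vs v B"
  shows "call_with P f vs Q \<longleftrightarrow> Q v (run_time P f vs)"
  using computesE[OF assms] evalto_deterministic(1)[OF computesE(2)[OF assms]]
  unfolding call_with_def evals_with_def by blast

lemmas run_time_le = computesE(3)

lemma computesI:
  "f < length P \<Longrightarrow> evals_with P vs (P ! f) (\<lambda>w t. w = v \<and> t \<le> B) \<Longrightarrow> computes P f vs v B"
  unfolding computes_def call_with_def by blast

lemma computes_mono: "computes P f vs v B \<Longrightarrow> B \<le> B' \<Longrightarrow> computes P f vs v B'"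
  unfolding computes_def call_with_def evals_with_def by (meson order_trans)

section \<open>The program\<close>

abbreviation (input) ETrue :: exp where "ETrue \<equiv> EPair EAtom EAtom"
abbreviation (input) EFalse :: exp where "EFalse \<equiv> EAtom"

abbreviation (input) "main_fn \<equiv> 0 :: nat"
abbreviation (input) "eq_fn \<equiv> Suc 0"
abbreviation (input) "share_fn \<equiv> 2 :: nat"
abbreviation (input) "conflict_fn \<equiv> 3 :: nat"
abbreviation (input) "blocked_fn \<equiv> 4 :: nat"
abbreviation (input) "extend_fn \<equiv> 5 :: nat"
abbreviation (input) "longer_fn \<equiv> 6 :: nat"
abbreviation (input) "exchange_fn \<equiv> 7 :: nat"
abbreviation (input) "improve_with_fn \<equiv> 8 :: nat"
abbreviation (input) "improve_fn \<equiv> 9 :: nat"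
abbreviation (input) "local_search_fn \<equiv> 10 :: nat"
abbreviation (input) "half_fn \<equiv> 11 :: nat"
abbreviation (input) "at_least_fn \<equiv> 12 :: nat"
abbreviation (input) "incident_fn \<equiv> 13 :: nat"
abbreviation (input) "consistent_fn \<equiv> 14 :: nat"
abbreviation (input) "touches_fn \<equiv> 15 :: nat"
abbreviation (input) "member_fn \<equiv> 16 :: nat"
abbreviation (input) "stage_edges_fn \<equiv> 17 :: nat"
abbreviation (input) "filter_consistent_fn \<equiv> 18 :: nat"
abbreviation (input) "solution_fn \<equiv> 19 :: nat"
abbreviation (input) "surplus_fn \<equiv> 20 :: nat"
abbreviation (input) "meets_fn \<equiv> 21 :: nat"
abbreviation (input) "disturbed_fn \<equiv> 22 :: nat"
abbreviation (input) "endpoints_fn \<equiv> 23 :: nat"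
abbreviation (input) "critical_fn \<equiv> 24 :: nat"
abbreviation (input) "search_fn \<equiv> 25 :: nat"
abbreviation (input) "branch_fn \<equiv> 26 :: nat"
abbreviation (input) "colours_fn \<equiv> 27 :: nat"
abbreviation (input) "same_edge_fn \<equiv> 28 :: nat"
abbreviation (input) "listed_fn \<equiv> 29 :: nat"
abbreviation (input) "select_fn \<equiv> 30 :: nat"

definition prog :: program where
  "prog = [
    \<comment> \<open>main: vertices, edges, colours, number, matching\<close>
    LetIn (Fst (Snd (Var 0)))
      (LetIn (Snd (Snd (Var 1)))
        (Call search_fn [EPair EAtom (EPair EAtom EAtom), EAtom,
          Call select_fn [Snd (Snd (Var 0)), Var 1], Var 1, Fst (Var 0), Fst (Snd (Var 0))])),
    \<comment> \<open>eq a b\<close>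
    IfPair (Var 0)
      (IfPair (Var 1)
        (IfPair (Call eq_fn [Fst (Var 0), Fst (Var 1)])
          (Call eq_fn [Snd (Var 0), Snd (Var 1)]) EFalse)
        EFalse)
      (IfPair (Var 1) EFalse ETrue),
    \<comment> \<open>share e f\<close>
    IfPair (Call eq_fn [Fst (Fst (Var 0)), Fst (Fst (Var 1))]) ETrue
      (IfPair (Call eq_fn [Fst (Fst (Var 0)), Snd (Fst (Var 1))]) ETrue
        (IfPair (Call eq_fn [Snd (Fst (Var 0)), Fst (Fst (Var 1))]) ETrue
          (Call eq_fn [Snd (Fst (Var 0)), Snd (Fst (Var 1))]))),
    \<comment> \<open>conflict e f\<close>
    IfPair (Call share_fn [Var 0, Var 1])
      (IfPair (Call eq_fn [Snd (Var 0), Snd (Var 1)]) EFalse ETrue) EFalse,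
    \<comment> \<open>blocked e acc\<close>
    IfPair (Var 1)
      (IfPair (Call eq_fn [Var 0, Fst (Var 1)]) ETrue
        (IfPair (Call conflict_fn [Var 0, Fst (Var 1)]) ETrue
          (Call blocked_fn [Var 0, Snd (Var 1)])))
      EFalse,
    \<comment> \<open>extend acc es\<close>
    IfPair (Var 1)
      (IfPair (Call blocked_fn [Fst (Var 1), Var 0])
        (Call extend_fn [Var 0, Snd (Var 1)])
        (Call extend_fn [EPair (Fst (Var 1)) (Var 0), Snd (Var 1)]))
      (Var 0),
    \<comment> \<open>longer F G\<close>
    IfPair (Var 1)
      (IfPair (Var 0) (Call longer_fn [Snd (Var 0), Snd (Var 1)]) ETrue) EFalse,
    \<comment> \<open>exchange e1 e2 F L\<close>
    Call extend_fn [Call extend_fn [Call extend_fn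
      [EAtom, EPair (Var 0) (EPair (Var 1) EAtom)], Var 2], Var 3],
    \<comment> \<open>improve_with e1 es F L\<close>
    IfPair (Var 1)
      (LetIn (Call exchange_fn [Var 0, Fst (Var 1), Var 2, Var 3])
        (IfPair (Call longer_fn [Var 3, Var 0]) (Var 0)
          (Call improve_with_fn [Var 1, Snd (Var 2), Var 3, Var 4])))
      EAtom,
    \<comment> \<open>improve es F L\<close>
    IfPair (Var 0)
      (LetIn (Call improve_with_fn [Fst (Var 0), Var 2, Var 1, Var 2])
        (IfPair (Var 0) (Var 0) (Call improve_fn [Snd (Var 1), Var 2, Var 3])))
      EAtom,
    \<comment> \<open>local_search fuel F L\<close>
    IfPair (Var 0)
      (LetIn (Call improve_fn [Var 2, Var 1, Var 2])
        (IfPair (Var 0) (Call local_search_fn [Snd (Var 1), Var 0, Var 3]) (Var 2)))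
      (Var 1),
    \<comment> \<open>half xs\<close>
    IfPair (Var 0)
      (IfPair (Snd (Var 0)) (EPair (Fst (Var 0)) (Call half_fn [Snd (Snd (Var 0))])) EAtom)
      EAtom,
    \<comment> \<open>at_least k xs\<close>
    IfPair (Var 0)
      (IfPair (Fst (Var 0))
        (IfPair (Var 1)
          (Call at_least_fn [Snd (Var 0), Call half_fn [Snd (Var 1)]]) EFalse)
        (Call at_least_fn [Snd (Var 0), Call half_fn [Var 1]]))
      ETrue,
    \<comment> \<open>incident x e\<close>
    IfPair (Call eq_fn [Var 0, Fst (Fst (Var 1))]) ETrue
      (Call eq_fn [Var 0, Snd (Fst (Var 1))]),
    \<comment> \<open>consistent phi e\<close>
    IfPair (Var 0)
      (IfPair (Call incident_fn [Fst (Fst (Var 0)), Var 1])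
        (IfPair (Call eq_fn [Snd (Var 1), Snd (Fst (Var 0))])
          (Call consistent_fn [Snd (Var 0), Var 1]) EFalse)
        (Call consistent_fn [Snd (Var 0), Var 1]))
      ETrue,
    \<comment> \<open>touches phi e\<close>
    IfPair (Var 0)
      (IfPair (Call incident_fn [Fst (Fst (Var 0)), Var 1]) ETrue
        (Call touches_fn [Snd (Var 0), Var 1]))
      EFalse,
    \<comment> \<open>member e es\<close>
    IfPair (Var 1)
      (IfPair (Call eq_fn [Var 0, Fst (Var 1)]) ETrue (Call member_fn [Var 0, Snd (Var 1)]))
      EFalse,
    \<comment> \<open>stage_edges j phi ms es\<close>
    IfPair (Var 3)
      (LetIn (Call stage_edges_fn [Var 0, Var 1, Var 2, Snd (Var 3)])
        (IfPair (Call consistent_fn [Var 2, Fst (Var 4)])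
          (IfPair (Var 1) (EPair (Fst (Var 4)) (Var 0))
            (IfPair (Call touches_fn [Var 2, Fst (Var 4)]) (EPair (Fst (Var 4)) (Var 0))
              (IfPair (Call member_fn [Fst (Var 4), Var 3]) (EPair (Fst (Var 4)) (Var 0))
                (Var 0))))
          (Var 0)))
      EAtom,
    \<comment> \<open>filter (consistent phi) ms\<close>
    IfPair (Var 1)
      (LetIn (Call filter_consistent_fn [Var 0, Snd (Var 1)])
        (IfPair (Call consistent_fn [Var 1, Fst (Var 2)]) (EPair (Fst (Var 2)) (Var 0)) (Var 0)))
      EAtom,
    \<comment> \<open>solution j phi ms es\<close>
    LetIn (Call stage_edges_fn [Var 0, Var 1, Var 2, Var 3])
      (Call local_search_fn [Var 0,
        Call extend_fn [Call extend_fn [EAtom, Call filter_consistent_fn [Var 2, Var 3]], Var 0],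
        Var 0]),
    \<comment> \<open>surplus ms F\<close>
    IfPair (Var 1)
      (LetIn (Call surplus_fn [Var 0, Snd (Var 1)])
        (IfPair (Call member_fn [Fst (Var 2), Var 1]) (Var 0) (EPair (Fst (Var 2)) (Var 0))))
      EAtom,
    \<comment> \<open>meets p D\<close>
    IfPair (Var 1)
      (IfPair (Call share_fn [Var 0, Fst (Var 1)]) ETrue (Call meets_fn [Var 0, Snd (Var 1)]))
      EFalse,
    \<comment> \<open>disturbed F D ms\<close>
    IfPair (Var 2)
      (LetIn (Call disturbed_fn [Var 0, Var 1, Snd (Var 2)])
        (IfPair (Call member_fn [Fst (Var 3), Var 1])
          (IfPair (Call meets_fn [Fst (Var 3), Var 2]) (EPair (Fst (Var 3)) (Var 0)) (Var 0))
          (EPair (Fst (Var 3)) (Var 0))))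
      EAtom,
    \<comment> \<open>endpoints es xs\<close>
    IfPair (Var 0)
      (EPair (Fst (Fst (Fst (Var 0)))) (EPair (Snd (Fst (Fst (Var 0))))
        (Call endpoints_fn [Snd (Var 0), Var 1])))
      (Var 1),
    \<comment> \<open>critical ms F\<close>
    LetIn (Call surplus_fn [Var 0, Var 1])
      (Call endpoints_fn [Var 0,
        Call endpoints_fn [Call disturbed_fn [Var 2, Var 0, Var 1], EAtom]]),
    \<comment> \<open>search j phi ms es cs k\<close>
    LetIn (Call solution_fn [Var 0, Var 1, Var 2, Var 3])
      (IfPair (Call at_least_fn [Var 6, Var 0]) ETrue
        (IfPair (Var 1)
          (Call branch_fn [Call critical_fn [Var 3, Var 0], Snd (Var 1),
            Var 2, Var 3, Var 4, Var 5, Var 6])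
          EFalse)),
    \<comment> \<open>branch xs j phi ms es cs k\<close>
    IfPair (Var 0)
      (Call colours_fn [Var 5, Var 0, Var 1, Var 2, Var 3, Var 4, Var 5, Var 6])
      (Call search_fn [Var 1, Var 2, Var 3, Var 4, Var 5, Var 6]),
    \<comment> \<open>colours rest xs j phi ms es cs k\<close>
    IfPair (Var 0)
      (IfPair (Call branch_fn [Snd (Var 1), Var 2,
          EPair (EPair (Fst (Var 1)) (Fst (Var 0))) (Var 3), Var 4, Var 5, Var 6, Var 7])
        ETrue
        (Call colours_fn [Snd (Var 0), Var 1, Var 2, Var 3, Var 4, Var 5, Var 6, Var 7]))
      EFalse,
    \<comment> \<open>same_edge m e\<close>
    IfPair (Call eq_fn [Fst (Var 0), Fst (Fst (Var 1))])
      (IfPair (Call eq_fn [Snd (Var 0), Snd (Fst (Var 1))]) ETrue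
        (IfPair (Call eq_fn [Fst (Var 0), Snd (Fst (Var 1))])
          (Call eq_fn [Snd (Var 0), Fst (Fst (Var 1))]) EFalse))
      (IfPair (Call eq_fn [Fst (Var 0), Snd (Fst (Var 1))])
        (Call eq_fn [Snd (Var 0), Fst (Fst (Var 1))]) EFalse),
    \<comment> \<open>listed m e\<close>
    IfPair (Var 0)
      (IfPair (Call same_edge_fn [Fst (Var 0), Var 1]) ETrue
        (Call listed_fn [Snd (Var 0), Var 1]))
      EFalse,
    \<comment> \<open>select m es\<close>
    IfPair (Var 1)
      (LetIn (Call select_fn [Var 0, Snd (Var 1)])
        (IfPair (Call listed_fn [Var 1, Fst (Var 2)]) (EPair (Fst (Var 2)) (Var 0)) (Var 0)))
      EAtom]"

lemma length_prog: "length prog = 31"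
  by (simp add: prog_def)

lemmas prog_nth = arg_cong[OF prog_def, of "\<lambda>P. P ! f" for f]

definition enc_bool :: "bool \<Rightarrow> data" where
  "enc_bool b = (if b then Pair Atom Atom else Atom)"

lemma enc_bool_simps [simp]: "enc_bool True = Pair Atom Atom" "enc_bool False = Atom"
  by (simp_all add: enc_bool_def)

lemma case_enc_bool [simp]: "(case enc_bool b of Atom \<Rightarrow> x | Pair v w \<Rightarrow> y v w) = (if b then y Atom Atom else x)"
  by (simp add: enc_bool_def)

abbreviation "computes_in \<equiv> computes prog"
abbreviation "time_of \<equiv> run_time prog"

lemma computes_prog:
  "f < 31 \<Longrightarrow> evals_with prog vs (prog ! f) (\<lambda>w t. w = v \<and> t \<le> B) \<Longrightarrow> computes_in f vs v B"
  by (rule computesI) (simp_all add: length_prog)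

text \<open>The recursion descends along the first tree and stops at its leaves, so the bound is
  independent of the second tree.\<close>

lemma eq_computes: "computes_in eq_fn [a, b] (enc_bool (a = b)) (80 * size a + 40)"
proof (induction a arbitrary: b)
  case Atom
  show ?case
    by (rule computes_prog; cases b) (simp_all add: prog_nth evals_with_simps)
next
  case (Pair a1 a2)
  show ?case
  proof (cases b)
    case Atom
    show ?thesis
      by (rule computes_prog) (simp_all add: prog_nth evals_with_simps Atom)
  next
    case (Pair b1 b2)
    show ?thesis
      using Pair.IH(1)[of b1, THEN run_time_le] Pair.IH(2)[of b2, THEN run_time_le]
      by (intro computes_prog)
        (auto simp: prog_nth evals_with_simps Pair Pair.IH[THEN call_with_eq])
  qed
qed

section \<open>Running times\<close>

definition enc_cedge :: "(nat, nat) cedge \<Rightarrow> data" where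
  "enc_cedge e = Pair (enc_edge (fst e)) (enc_nat (snd e))"

abbreviation "enc_cedges \<equiv> enc_list enc_cedge"

text \<open>What is bounded is the written length of a number, not its value; this is the quantity
  on which the cost of a comparison depends.\<close>

definition small :: "nat \<Rightarrow> nat \<Rightarrow> bool" where
  "small N n \<longleftrightarrow> size (enc_nat n) \<le> N"

definition small_edge :: "nat \<Rightarrow> (nat, nat) cedge \<Rightarrow> bool" where
  "small_edge N e \<longleftrightarrow> small N (fst (fst e)) \<and> small N (snd (fst e)) \<and> small N (snd e)"

lemma enc_nat_inject [simp]: "enc_nat m = enc_nat n \<longleftrightarrow> m = n"
proof
  show "enc_nat m = enc_nat n \<Longrightarrow> m = n"
  proof (induction m arbitrary: n rule: less_induct)
    case (less m)
    show ?case
    proof (cases "m = 0 \<or> n = 0")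
      case True
      with less.prems show ?thesis
        by (subst (asm) (1 2) enc_nat.simps) (auto split: if_splits)
    next
      case False
      then have eq: "(odd m \<longleftrightarrow> odd n) \<and> enc_nat (m div 2) = enc_nat (n div 2)"
        using less.prems by (subst (asm) (1 2) enc_nat.simps) (auto split: if_splits)
      then have "m div 2 = n div 2"
        using less.IH[of "m div 2"] False by simp
      with eq show ?thesis
        by (metis bit_eq_rec)
    qed
  qed
qed simp

lemma enc_cedge_inject [simp]: "enc_cedge e = enc_cedge f \<longleftrightarrow> e = f"
  by (cases e; cases f; cases "fst e"; cases "fst f") (auto simp: enc_cedge_def)

lemma enc_cedge_data [simp]:
  "fst_data (fst_data (enc_cedge e)) = enc_nat (fst (fst e))"
  "snd_data (fst_data (enc_cedge e)) = enc_nat (snd (fst e))"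
  "snd_data (enc_cedge e) = enc_nat (snd e)"
  by (cases e; cases "fst e"; simp add: enc_cedge_def)+

lemma size_enc_cedge: "small_edge N e \<Longrightarrow> size (enc_cedge e) \<le> 3 * N + 2"
  by (cases e; cases "fst e") (auto simp: enc_cedge_def small_edge_def small_def)

lemma eq_time: "small N a \<Longrightarrow> time_of eq_fn [enc_nat a, d] \<le> 80 * N + 40"
  using eq_computes[THEN run_time_le, of "enc_nat a" d] by (simp add: small_def)

lemma eq_time_cedge: "small_edge N e \<Longrightarrow> time_of eq_fn [enc_cedge e, d] \<le> 240 * N + 200"
  using eq_computes[THEN run_time_le, of "enc_cedge e" d] size_enc_cedge[of N e] by simp

lemmas call_eq = eq_computes[THEN call_with_eq]

lemma ends_inter: "ends e \<inter> ends f \<noteq> {} \<longleftrightarrow>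
    fst (fst e) = fst (fst f) \<or> fst (fst e) = snd (fst f) \<or>
    snd (fst e) = fst (fst f) \<or> snd (fst e) = snd (fst f)"
  by (cases e; cases f; cases "fst e"; cases "fst f") auto

lemma ends_iff: "x \<in> ends e \<longleftrightarrow> x = fst (fst e) \<or> x = snd (fst e)"
  by (cases e; cases "fst e") auto

lemma share_computes:
  assumes "small_edge N e"
  shows "computes_in share_fn [enc_cedge e, enc_cedge f] (enc_bool (ends e \<inter> ends f \<noteq> {}))
    (320 * N + 260)"
proof -
  have "small N (fst (fst e))" "small N (snd (fst e))"
    using assms by (simp_all add: small_edge_def)
  note time = this[THEN eq_time]
  show ?thesis
    unfolding ends_inter
    using time(1)[of "enc_nat (fst (fst f))"] time(1)[of "enc_nat (snd (fst f))"]
      time(2)[of "enc_nat (fst (fst f))"] time(2)[of "enc_nat (snd (fst f))"]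
    by (intro computes_prog) (auto simp: prog_nth evals_with_simps call_eq)
qed

lemmas call_share = share_computes[THEN call_with_eq]
lemmas share_time = share_computes[THEN run_time_le]

lemma conflict_computes:
  assumes "small_edge N e"
  shows "computes_in conflict_fn [enc_cedge e, enc_cedge f] (enc_bool (conflict e f))
    (400 * N + 400)"
proof -
  have "small N (snd e)"
    using assms by (simp add: small_edge_def)
  then show ?thesis
    unfolding conflict_def
    using eq_time[of N "snd e" "enc_nat (snd f)"] share_time[OF assms, of f]
    by (intro computes_prog) (auto simp: prog_nth evals_with_simps call_eq call_share[OF assms])
qed

lemmas call_conflict = conflict_computes[THEN call_with_eq]
lemmas conflict_time = conflict_computes[THEN run_time_le]

lemma blocked_computes:
  assumes "small_edge N e"
  shows "computes_in blocked_fn [enc_cedge e, enc_cedges acc] (enc_bool (blocked e acc))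
    (Suc (length acc) * (640 * N + 700))"
proof (induction acc)
  case Nil
  show ?case
    by (intro computes_prog) (simp_all add: prog_nth evals_with_simps blocked_def)
next
  case (Cons f acc)
  have b: "blocked e (f # acc) \<longleftrightarrow> e = f \<or> conflict e f \<or> blocked e acc"
    by (auto simp: blocked_def)
  show ?case
    unfolding b
    using eq_time_cedge[OF assms, of "enc_cedge f"] conflict_time[OF assms, of f]
      Cons.IH[THEN run_time_le]
    by (intro computes_prog)
      (auto simp: prog_nth evals_with_simps call_eq call_conflict[OF assms]
        Cons.IH[THEN call_with_eq])
qed

lemmas call_blocked = blocked_computes[THEN call_with_eq]

text \<open>In an exchange the accumulator holds at most the two seeds, \<open>F\<close> and
  \<open>L\<close>, that is \<open>2 * N + 2\<close> edges.\<close>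

definition t_blocked :: "nat \<Rightarrow> nat" where
  "t_blocked N = (2 * N + 3) * (640 * N + 700)"

lemma blocked_time:
  assumes "small_edge N e" "length acc \<le> 2 * N + 2"
  shows "time_of blocked_fn [enc_cedge e, enc_cedges acc] \<le> t_blocked N"
proof -
  have "Suc (length acc) * (640 * N + 700) \<le> t_blocked N"
    unfolding t_blocked_def using assms(2) by (intro mult_le_mono1) simp
  then show ?thesis
    using blocked_computes[OF assms(1), of acc, THEN run_time_le] by simp
qed

lemma extend_computes:
  assumes "\<forall>e\<in>set es. small_edge N e" "length acc + length es \<le> 2 * N + 2"
  shows "computes_in extend_fn [enc_cedges acc, enc_cedges es] (enc_cedges (extend acc es))
    (Suc (length es) * (t_blocked N + 100))"
  using assms
proof (induction es arbitrary: acc)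
  case Nil
  show ?case
    by (intro computes_prog) (simp_all add: prog_nth evals_with_simps)
next
  case (Cons e es)
  have IH: "computes_in extend_fn [enc_cedges acc, enc_cedges es] (enc_cedges (extend acc es))
      (Suc (length es) * (t_blocked N + 100))"
    "computes_in extend_fn [Pair (enc_cedge e) (enc_cedges acc), enc_cedges es]
      (enc_cedges (extend (e # acc) es)) (Suc (length es) * (t_blocked N + 100))"
    using Cons.IH[of acc] Cons.IH[of "e # acc"] Cons.prems by simp_all
  have e: "small_edge N e" using Cons.prems by simp
  show ?case
    using blocked_time[OF e, of acc] IH[THEN run_time_le] Cons.prems(2)
    by (intro computes_prog)
      (auto simp: prog_nth evals_with_simps call_blocked[OF e] IH[THEN call_with_eq])
qed

definition t_extend :: "nat \<Rightarrow> nat" where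
  "t_extend N = (N + 3) * (t_blocked N + 100)"

text \<open>The second alternative is the seed list of an exchange, whose two elements may exceed
  \<open>N\<close>.\<close>

lemma extend_computes':
  assumes "\<forall>e\<in>set es. small_edge N e" "length acc \<le> N + 2" "length es \<le> N \<or> acc = [] \<and> length es = 2"
  shows "computes_in extend_fn [enc_cedges acc, enc_cedges es] (enc_cedges (extend acc es))
    (t_extend N)"
proof (rule computes_mono[OF extend_computes[OF assms(1)]])
  show "length acc + length es \<le> 2 * N + 2"
    using assms(2,3) by auto
  show "Suc (length es) * (t_blocked N + 100) \<le> t_extend N"
    unfolding t_extend_def using assms(3) by (intro mult_le_mono1) auto
qed

lemma longer_computes:
  "computes_in longer_fn [enc_cedges F, enc_cedges G] (enc_bool (length F < length G))
    (Suc (length G) * 40)"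
proof (induction G arbitrary: F)
  case Nil
  show ?case
    by (intro computes_prog) (simp_all add: prog_nth evals_with_simps)
next
  case (Cons g G)
  show ?case
  proof (cases F)
    case Nil
    then show ?thesis
      by (intro computes_prog) (simp_all add: prog_nth evals_with_simps)
  next
    case (Cons f F')
    then show ?thesis
      using Cons.IH[of F', THEN run_time_le]
      by (intro computes_prog) (simp_all add: prog_nth evals_with_simps Cons.IH[THEN call_with_eq])
  qed
qed

lemmas call_longer = longer_computes[THEN call_with_eq]

lemma length_extend: "length (extend acc es) \<le> length acc + length es"
proof (induction es arbitrary: acc)
  case (Cons e es)
  show ?case using Cons.IH[of acc] Cons.IH[of "e # acc"] by simp
qed simp

lemma length_exchange: "length (exchange e1 e2 F L) \<le> 2 + length F + length L"
  unfolding exchange_def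
  using length_extend[of "extend (extend [] [e1, e2]) F" L] length_extend[of "extend [] [e1, e2]" F]
    length_extend[of "[]" "[e1, e2]"] by (simp del: extend.simps)

lemma exchange_computes:
  assumes "small_edge N e1" "small_edge N e2" "\<forall>e\<in>set F. small_edge N e" "\<forall>e\<in>set L. small_edge N e"
    and "length F \<le> N" "length L \<le> N"
  shows "computes_in exchange_fn [enc_cedge e1, enc_cedge e2, enc_cedges F, enc_cedges L]
    (enc_cedges (exchange e1 e2 F L)) (3 * t_extend N + 100)"
proof -
  let ?A = "extend [] [e1, e2]"
  have len: "length ?A \<le> 2"
    using length_extend[of "[]" "[e1, e2]"] by simp
  have len': "length (extend ?A F) \<le> N + 2"
    using length_extend[of ?A F] len assms(5) by linarith
  have 1: "computes_in extend_fn [Atom, Pair (enc_cedge e1) (Pair (enc_cedge e2) Atom)]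
      (enc_cedges ?A) (t_extend N)"
    using extend_computes'[of "[e1, e2]" N "[]"] assms(1,2) by (simp del: extend.simps)
  have 2: "computes_in extend_fn [enc_cedges ?A, enc_cedges F] (enc_cedges (extend ?A F)) (t_extend N)"
    using assms(3,5) len by (intro extend_computes') (simp_all del: extend.simps)
  have 3: "computes_in extend_fn [enc_cedges (extend ?A F), enc_cedges L]
      (enc_cedges (extend (extend ?A F) L)) (t_extend N)"
    using assms(4,6) len' by (intro extend_computes') (simp_all del: extend.simps)
  show ?thesis
    unfolding exchange_def
    using 1[THEN run_time_le] 2[THEN run_time_le] 3[THEN run_time_le]
    by (intro computes_prog)
      (simp_all add: prog_nth evals_with_simps 1[THEN call_with_eq] 2[THEN call_with_eq]
        3[THEN call_with_eq] del: extend.simps)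
qed

lemma improve_with_computes:
  assumes "small_edge N e1" "\<forall>e\<in>set F. small_edge N e" "\<forall>e\<in>set L. small_edge N e"
    and "length F \<le> N" "length L \<le> N" and "\<forall>e\<in>set es. small_edge N e"
  shows "computes_in improve_with_fn [enc_cedge e1, enc_cedges es, enc_cedges F, enc_cedges L]
    (enc_cedges (improve_with e1 es F L)) (Suc (length es) * (3 * t_extend N + 80 * N + 500))"
  using assms(6)
proof (induction es)
  case Nil
  show ?case
    by (intro computes_prog) (simp_all add: prog_nth evals_with_simps)
next
  case (Cons e2 es)
  have e2: "small_edge N e2" using Cons.prems by simp
  have IH: "computes_in improve_with_fn [enc_cedge e1, enc_cedges es, enc_cedges F, enc_cedges L]
    (enc_cedges (improve_with e1 es F L)) (Suc (length es) * (3 * t_extend N + 80 * N + 500))"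
    using Cons by simp
  note ex = exchange_computes[OF assms(1) e2 assms(2-5)]
  have len: "length (exchange e1 e2 F L) \<le> 2 * N + 2"
    using length_exchange[of e1 e2 F L] assms(4,5) by linarith
  have longer: "time_of longer_fn [enc_cedges F, enc_cedges (exchange e1 e2 F L)] \<le> 80 * N + 120"
    using longer_computes[of F "exchange e1 e2 F L", THEN run_time_le] len by simp
  show ?case
    using IH[THEN run_time_le] ex[THEN run_time_le] longer
    by (intro computes_prog)
      (auto simp: prog_nth evals_with_simps ex[THEN call_with_eq] call_longer
        IH[THEN call_with_eq] Let_def)
qed

definition t_improve_with :: "nat \<Rightarrow> nat" where
  "t_improve_with N = Suc N * (3 * t_extend N + 80 * N + 500)"

lemma enc_list_case [simp]:
  "(case enc_list enc xs of Atom \<Rightarrow> x | Pair v w \<Rightarrow> y) = (if xs = [] then x else y)"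
  by (cases xs) simp_all

lemma improve_computes:
  assumes "\<forall>e\<in>set F. small_edge N e" "\<forall>e\<in>set L. small_edge N e"
    and "length F \<le> N" "length L \<le> N" and "\<forall>e\<in>set es. small_edge N e"
  shows "computes_in improve_fn [enc_cedges es, enc_cedges F, enc_cedges L]
    (enc_cedges (improve es F L)) (Suc (length es) * (t_improve_with N + 100))"
  using assms(5)
proof (induction es)
  case Nil
  show ?case
    by (intro computes_prog) (simp_all add: prog_nth evals_with_simps)
next
  case (Cons e1 es)
  have e1: "small_edge N e1" using Cons.prems by simp
  have IH: "computes_in improve_fn [enc_cedges es, enc_cedges F, enc_cedges L]
    (enc_cedges (improve es F L)) (Suc (length es) * (t_improve_with N + 100))"
    using Cons by simp
  have iw: "computes_in improve_with_fn [enc_cedge e1, enc_cedges L, enc_cedges F, enc_cedges L]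
    (enc_cedges (improve_with e1 L F L)) (t_improve_with N)"
    unfolding t_improve_with_def
    by (rule computes_mono[OF improve_with_computes[OF e1 assms(1-4,2)]])
      (intro mult_le_mono1, simp add: assms(4))
  show ?case
    using IH[THEN run_time_le] iw[THEN run_time_le]
    by (intro computes_prog)
      (auto simp: prog_nth evals_with_simps iw[THEN call_with_eq] IH[THEN call_with_eq] Let_def)
qed

definition t_improve :: "nat \<Rightarrow> nat" where
  "t_improve N = Suc N * (t_improve_with N + 100)"

lemma local_search_computes:
  assumes "\<forall>e\<in>set L. small_edge N e" "length L \<le> N" "set F \<subseteq> set L" "distinct F"
  shows "computes_in local_search_fn [enc_list enc fuel, enc_cedges F, enc_cedges L]
    (enc_cedges (local_search fuel F L)) (Suc (length fuel) * (t_improve N + 100))"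
  using assms(3,4)
proof (induction fuel arbitrary: F)
  case Nil
  show ?case
    by (intro computes_prog) (simp_all add: prog_nth evals_with_simps)
next
  case (Cons x fuel)
  have len: "length F \<le> N"
    using distinct_subset_length[OF Cons.prems(2,1)] assms(2) by simp
  have F: "\<forall>e\<in>set F. small_edge N e"
    using assms(1) Cons.prems(1) by blast
  have im: "computes_in improve_fn [enc_cedges L, enc_cedges F, enc_cedges L]
    (enc_cedges (improve L F L)) (t_improve N)"
    unfolding t_improve_def
    by (rule computes_mono[OF improve_computes[OF F assms(1) len assms(2,1)]])
      (intro mult_le_mono1, simp add: assms(2))
  show ?case
  proof (cases "improve L F L = []")
    case True
    then show ?thesis
      using im[THEN run_time_le]
      by (intro computes_prog)
        (auto simp: prog_nth evals_with_simps im[THEN call_with_eq] Let_def)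
  next
    case False
    then obtain e1 e2 where e: "e1 \<in> set L" "e2 \<in> set L" "improve L F L = exchange e1 e2 F L"
      using improve_not_Nil by blast
    have G: "set (improve L F L) \<subseteq> set L" "distinct (improve L F L)"
      using exchange_subset[of e1 e2 F L] exchange_distinct[of e1 e2 F L] e Cons.prems(1) by auto
    note IH = Cons.IH[OF G]
    show ?thesis
      using im[THEN run_time_le] IH[THEN run_time_le] False
      by (intro computes_prog)
        (auto simp: prog_nth evals_with_simps im[THEN call_with_eq] IH[THEN call_with_eq] Let_def)
  qed
qed

definition t_local_search :: "nat \<Rightarrow> nat" where
  "t_local_search N = Suc N * (t_improve N + 100)"

section \<open>Comparing a list length with a binary number\<close>

fun half :: "'a list \<Rightarrow> 'a list" where
  "half (x # y # xs) = x # half xs"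
| "half xs = []"

lemma length_half: "length (half xs) = length xs div 2"
  by (induction xs rule: half.induct) auto

lemma half_computes:
  "computes_in half_fn [enc_list enc xs] (enc_list enc (half xs)) (Suc (length xs) * 40)"
proof (induction xs rule: half.induct)
  case (1 x y xs)
  then show ?case
    using 1[THEN run_time_le]
    by (intro computes_prog) (auto simp: prog_nth evals_with_simps 1[THEN call_with_eq])
qed (intro computes_prog; simp add: prog_nth evals_with_simps)+

lemmas call_half = half_computes[THEN call_with_eq]

text \<open>The value of \<open>k\<close> may be exponential in the input size, so it cannot be
  counted down. Each binary digit halves the list instead, after removal of one element if the digit
  is odd; the number of rounds is the number of digits.\<close>

lemma at_least_computes:
  assumes "length xs \<le> N"
  shows "computes_in at_least_fn [enc_nat k, enc_list enc xs] (enc_bool (k \<le> length xs))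
    (Suc (size (enc_nat k)) * (40 * N + 200))"
  using assms
proof (induction k arbitrary: xs rule: less_induct)
  case (less k)
  show ?case
  proof (cases "k = 0")
    case True
    then show ?thesis
      by (intro computes_prog) (simp_all add: prog_nth evals_with_simps enc_nat.simps[of 0])
  next
    case False
    let ?d = "if odd k then Pair Atom Atom else Atom"
    have enc: "enc_nat k = Pair ?d (enc_nat (k div 2))"
      using False by (subst enc_nat.simps) simp
    have half_time: "time_of half_fn [enc_list enc ys] \<le> 40 * N + 40" if "length ys \<le> N" for ys
      using half_computes[of enc ys, THEN run_time_le] that by simp
    have IH: "computes_in at_least_fn [enc_nat (k div 2), enc_list enc (half ys)]
        (enc_bool (k div 2 \<le> length ys div 2)) (Suc (size (enc_nat (k div 2))) * (40 * N + 200))"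
      if "length ys \<le> N" for ys
      using less.IH[of "k div 2" "half ys"] False that by (simp add: length_half)
    show ?thesis
    proof (cases "odd k")
      case True
      show ?thesis
      proof (cases xs)
        case Nil
        then show ?thesis
          using True False
          by (intro computes_prog) (simp_all add: prog_nth evals_with_simps enc)
      next
        case (Cons y ys)
        have len: "length ys \<le> N" using less.prems Cons by simp
        have "k \<le> length xs \<longleftrightarrow> k div 2 \<le> length ys div 2"
          using True unfolding Cons by (auto elim!: oddE)
        then show ?thesis
          using True half_time[OF len] IH[OF len, THEN run_time_le]
          by (intro computes_prog)
            (simp_all add: prog_nth evals_with_simps enc Cons call_half IH[OF len, THEN call_with_eq])
      qed
    next
      case even: False
      have "k \<le> length xs \<longleftrightarrow> k div 2 \<le> length xs div 2"
        using even by (auto elim!: evenE)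
      then show ?thesis
        using even half_time[OF less.prems] IH[OF less.prems, THEN run_time_le]
        by (intro computes_prog)
          (simp_all add: prog_nth evals_with_simps enc call_half IH[OF less.prems, THEN call_with_eq])
    qed
  qed
qed

lemma incident_computes:
  assumes "small N x"
  shows "computes_in incident_fn [enc_nat x, enc_cedge e] (enc_bool (x \<in> ends e)) (160 * N + 140)"
  unfolding ends_iff
  using eq_time[OF assms, of "enc_nat (fst (fst e))"] eq_time[OF assms, of "enc_nat (snd (fst e))"]
  by (intro computes_prog) (auto simp: prog_nth evals_with_simps call_eq)

lemmas call_incident = incident_computes[THEN call_with_eq]
lemmas incident_time = incident_computes[THEN run_time_le]

lemma consistent_computes:
  assumes "\<forall>p\<in>set \<phi>. small N (fst p)" "small_edge N e"
  shows "computes_in consistent_fn [enc_list enc_edge \<phi>, enc_cedge e] (enc_bool (consistent \<phi> e))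
    (Suc (length \<phi>) * (240 * N + 300))"
  using assms(1)
proof (induction \<phi>)
  case Nil
  show ?case
    by (intro computes_prog) (simp_all add: prog_nth evals_with_simps consistent_def)
next
  case (Cons p \<phi>)
  obtain x c where p: "p = (x, c)" by (cases p)
  have x: "small N x" and e: "small N (snd e)"
    using Cons.prems assms(2) by (simp_all add: p small_edge_def)
  have IH: "computes_in consistent_fn [enc_list enc_edge \<phi>, enc_cedge e] (enc_bool (consistent \<phi> e))
    (Suc (length \<phi>) * (240 * N + 300))"
    using Cons by simp
  have eq: "consistent (p # \<phi>) e \<longleftrightarrow> (x \<in> ends e \<longrightarrow> snd e = c) \<and> consistent \<phi> e"
    by (simp add: consistent_def p)
  show ?case
    unfolding eq
    using incident_time[OF x, of e] eq_time[OF e, of "enc_nat c"] IH[THEN run_time_le]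
    by (intro computes_prog)
      (auto simp: prog_nth evals_with_simps p call_incident[OF x] call_eq IH[THEN call_with_eq])
qed

lemma touches_computes:
  assumes "\<forall>p\<in>set \<phi>. small N (fst p)"
  shows "computes_in touches_fn [enc_list enc_edge \<phi>, enc_cedge e] (enc_bool (touches \<phi> e))
    (Suc (length \<phi>) * (240 * N + 300))"
  using assms
proof (induction \<phi>)
  case Nil
  show ?case
    by (intro computes_prog) (simp_all add: prog_nth evals_with_simps touches_def)
next
  case (Cons p \<phi>)
  obtain x c where p: "p = (x, c)" by (cases p)
  have x: "small N x"
    using Cons.prems by (simp add: p)
  have IH: "computes_in touches_fn [enc_list enc_edge \<phi>, enc_cedge e] (enc_bool (touches \<phi> e))
    (Suc (length \<phi>) * (240 * N + 300))"
    using Cons by simp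
  have eq: "touches (p # \<phi>) e \<longleftrightarrow> x \<in> ends e \<or> touches \<phi> e"
    by (simp add: touches_def p)
  show ?case
    unfolding eq
    using incident_time[OF x, of e] IH[THEN run_time_le]
    by (intro computes_prog)
      (auto simp: prog_nth evals_with_simps p call_incident[OF x] IH[THEN call_with_eq])
qed

lemma member_computes:
  assumes "small_edge N e"
  shows "computes_in member_fn [enc_cedge e, enc_cedges es] (enc_bool (e \<in> set es))
    (Suc (length es) * (240 * N + 300))"
proof (induction es)
  case Nil
  show ?case
    by (intro computes_prog) (simp_all add: prog_nth evals_with_simps)
next
  case (Cons f es)
  show ?case
    using eq_time_cedge[OF assms, of "enc_cedge f"] Cons.IH[THEN run_time_le]
    by (intro computes_prog)
      (auto simp: prog_nth evals_with_simps call_eq Cons.IH[THEN call_with_eq])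
qed

text \<open>The longest lists scanned are partial colourings, with at most \<open>4 * N\<close>
  vertices from each of two stages. The second factor is that of the dearest scans,
  \<open>meets_fn\<close> and \<open>listed_fn\<close>.\<close>

definition t_scan :: "nat \<Rightarrow> nat" where
  "t_scan N = Suc (8 * N) * (320 * N + 400)"

lemma scan_le:
  assumes "computes_in f vs v (Suc n * (240 * N + 300))" "n \<le> 8 * N"
  shows "computes_in f vs v (t_scan N)"
  using assms(1)
proof (rule computes_mono)
  show "Suc n * (240 * N + 300) \<le> t_scan N"
    unfolding t_scan_def using assms(2) by (intro mult_le_mono) simp_all
qed

text \<open>Stage numbers are unary, so that a test for the atom recognises the last stage and
  taking the second component steps down.\<close>

fun enc_unary :: "nat \<Rightarrow> data" where
  "enc_unary 0 = Atom"
| "enc_unary (Suc n) = Pair Atom (enc_unary n)"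

lemma enc_unary_case [simp]:
  "(case enc_unary n of Atom \<Rightarrow> x | Pair v w \<Rightarrow> y) = (if n = 0 then x else y)"
  by (cases n) simp_all

lemma stage_edges_computes:
  assumes "\<forall>p\<in>set \<phi>. small N (fst p)" "length \<phi> \<le> 8 * N" "length ms \<le> 8 * N"
    and "\<forall>e\<in>set es. small_edge N e"
  shows "computes_in stage_edges_fn
    [enc_unary j, enc_list enc_edge \<phi>, enc_cedges ms, enc_cedges es]
    (enc_cedges (filter (\<lambda>e. consistent \<phi> e \<and> (j \<noteq> 0 \<or> touches \<phi> e \<or> e \<in> set ms)) es))
    (Suc (length es) * (3 * t_scan N + 200))"
  using assms(4)
proof (induction es)
  case Nil
  show ?case
    by (intro computes_prog) (simp_all add: prog_nth evals_with_simps)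
next
  case (Cons e es)
  let ?r = "filter (\<lambda>e. consistent \<phi> e \<and> (j \<noteq> 0 \<or> touches \<phi> e \<or> e \<in> set ms)) es"
  have e: "small_edge N e" using Cons.prems by simp
  have IH: "computes_in stage_edges_fn
      [enc_unary j, enc_list enc_edge \<phi>, enc_cedges ms, enc_cedges es]
      (enc_cedges ?r) (Suc (length es) * (3 * t_scan N + 200))"
    using Cons by simp
  note c = scan_le[OF consistent_computes[OF assms(1) e] assms(2)]
  note t = scan_le[OF touches_computes[OF assms(1)] assms(2), of e]
  note m = scan_le[OF member_computes[OF e] assms(3)]
  show ?case
    using IH[THEN run_time_le] c[THEN run_time_le] t[THEN run_time_le] m[THEN run_time_le]
    by (intro computes_prog)
      (auto simp: prog_nth evals_with_simps IH[THEN call_with_eq] c[THEN call_with_eq]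
        t[THEN call_with_eq] m[THEN call_with_eq])
qed

lemma filter_consistent_computes:
  assumes "\<forall>p\<in>set \<phi>. small N (fst p)" "length \<phi> \<le> 8 * N" "\<forall>e\<in>set ms. small_edge N e"
  shows "computes_in filter_consistent_fn [enc_list enc_edge \<phi>, enc_cedges ms]
    (enc_cedges (filter (consistent \<phi>) ms)) (Suc (length ms) * (t_scan N + 100))"
  using assms(3)
proof (induction ms)
  case Nil
  show ?case
    by (intro computes_prog) (simp_all add: prog_nth evals_with_simps)
next
  case (Cons e ms)
  have e: "small_edge N e" using Cons.prems by simp
  have IH: "computes_in filter_consistent_fn [enc_list enc_edge \<phi>, enc_cedges ms]
    (enc_cedges (filter (consistent \<phi>) ms)) (Suc (length ms) * (t_scan N + 100))"
    using Cons by simp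
  note c = scan_le[OF consistent_computes[OF assms(1) e] assms(2)]
  show ?case
    using IH[THEN run_time_le] c[THEN run_time_le]
    by (intro computes_prog)
      (auto simp: prog_nth evals_with_simps IH[THEN call_with_eq] c[THEN call_with_eq])
qed

lemma surplus_computes:
  assumes "length ms \<le> 8 * N" "\<forall>e\<in>set F. small_edge N e"
  shows "computes_in surplus_fn [enc_cedges ms, enc_cedges F]
    (enc_cedges (filter (\<lambda>e. e \<notin> set ms) F)) (Suc (length F) * (t_scan N + 100))"
  using assms(2)
proof (induction F)
  case Nil
  show ?case
    by (intro computes_prog) (simp_all add: prog_nth evals_with_simps)
next
  case (Cons e F)
  have e: "small_edge N e" using Cons.prems by simp
  have IH: "computes_in surplus_fn [enc_cedges ms, enc_cedges F]
    (enc_cedges (filter (\<lambda>e. e \<notin> set ms) F)) (Suc (length F) * (t_scan N + 100))"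
    using Cons by simp
  note m = scan_le[OF member_computes[OF e] assms(1)]
  show ?case
    using IH[THEN run_time_le] m[THEN run_time_le]
    by (intro computes_prog)
      (auto simp: prog_nth evals_with_simps IH[THEN call_with_eq] m[THEN call_with_eq])
qed

lemma meets_computes:
  assumes "small_edge N p"
  shows "computes_in meets_fn [enc_cedge p, enc_cedges D]
    (enc_bool (\<exists>e\<in>set D. ends p \<inter> ends e \<noteq> {})) (Suc (length D) * (320 * N + 400))"
proof (induction D)
  case Nil
  show ?case
    by (intro computes_prog) (simp_all add: prog_nth evals_with_simps)
next
  case (Cons e D)
  have eq: "(\<exists>f\<in>set (e # D). ends p \<inter> ends f \<noteq> {}) \<longleftrightarrow>
      ends p \<inter> ends e \<noteq> {} \<or> (\<exists>e\<in>set D. ends p \<inter> ends e \<noteq> {})"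
    by simp
  show ?case
    unfolding eq
    using share_time[OF assms, of e] Cons.IH[THEN run_time_le]
    by (intro computes_prog)
      (simp_all add: prog_nth evals_with_simps call_share[OF assms] Cons.IH[THEN call_with_eq])
qed

lemma disturbed_computes:
  assumes "length F \<le> 8 * N" "length D \<le> 8 * N" "\<forall>e\<in>set ms. small_edge N e"
  shows "computes_in disturbed_fn [enc_cedges F, enc_cedges D, enc_cedges ms]
    (enc_cedges (filter (\<lambda>p. p \<notin> set F \<or> (\<exists>e\<in>set D. ends p \<inter> ends e \<noteq> {})) ms))
    (Suc (length ms) * (2 * t_scan N + 150))"
  using assms(3)
proof (induction ms)
  case Nil
  show ?case
    by (intro computes_prog) (simp_all add: prog_nth evals_with_simps)
next
  case (Cons p ms)
  have p: "small_edge N p" using Cons.prems by simp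
  have IH: "computes_in disturbed_fn [enc_cedges F, enc_cedges D, enc_cedges ms]
    (enc_cedges (filter (\<lambda>p. p \<notin> set F \<or> (\<exists>e\<in>set D. ends p \<inter> ends e \<noteq> {})) ms))
    (Suc (length ms) * (2 * t_scan N + 150))"
    using Cons by simp
  note m = scan_le[OF member_computes[OF p] assms(1)]
  have d: "computes_in meets_fn [enc_cedge p, enc_cedges D]
    (enc_bool (\<exists>e\<in>set D. ends p \<inter> ends e \<noteq> {})) (t_scan N)"
    by (rule computes_mono[OF meets_computes[OF p]])
      (use assms(2) in \<open>simp add: t_scan_def del: mult_Suc\<close>)
  show ?case
    using IH[THEN run_time_le] m[THEN run_time_le] d[THEN run_time_le]
    by (intro computes_prog)
      (simp_all add: prog_nth evals_with_simps IH[THEN call_with_eq] m[THEN call_with_eq]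
        d[THEN call_with_eq])
qed

lemma endpoints_computes:
  "computes_in endpoints_fn [enc_cedges es, enc_list enc_nat xs]
    (enc_list enc_nat (endpoints es xs)) (Suc (length es) * 100)"
proof (induction es)
  case Nil
  show ?case
    by (intro computes_prog) (simp_all add: prog_nth evals_with_simps)
next
  case (Cons e es)
  show ?case
    using Cons.IH[THEN run_time_le]
    by (intro computes_prog)
      (simp_all add: prog_nth evals_with_simps Cons.IH[THEN call_with_eq])
qed

definition t_solution :: "nat \<Rightarrow> nat" where
  "t_solution N = Suc N * (4 * t_scan N + 300) + 2 * t_extend N + t_local_search N + 200"

definition t_critical :: "nat \<Rightarrow> nat" where
  "t_critical N = Suc N * (3 * t_scan N + 450) + 150"

definition t_search :: "nat \<Rightarrow> nat" where
  "t_search N = t_solution N + Suc N * (40 * N + 200) + t_critical N + 200"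

section \<open>Running time of the search tree\<close>

locale machine = clustering es ms cs k for es ms :: "(nat, nat) cedge list" and cs k +
  fixes N :: nat
  assumes small_es: "\<forall>e\<in>set es. small_edge N e" and length_es: "length es \<le> N"
    and size_k: "size (enc_nat k) \<le> N"
begin

definition admissible :: "(nat \<times> nat) list \<Rightarrow> bool" where
  "admissible \<phi> \<longleftrightarrow> (\<forall>p\<in>set \<phi>. small N (fst p)) \<and> length \<phi> \<le> 8 * N"

lemma small_ms: "\<forall>e\<in>set ms. small_edge N e"
  using small_es ms_subset by blast

lemma length_ms: "length ms \<le> N"
  using distinct_subset_length[OF distinct_ms ms_subset] length_es by linarith

lemma small_solution: "\<forall>e\<in>set (solution j \<phi>). small_edge N e"
  using small_es order_trans[OF solution_props(1) set_stage_edges_subset] by blast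

lemma length_solution: "length (solution j \<phi>) \<le> N"
  using distinct_subset_length[OF solution_props(2) order_trans[OF solution_props(1) set_stage_edges_subset]]
    length_es by (rule order_trans)

lemma solution_computes:
  assumes "admissible \<phi>"
  shows "computes_in solution_fn
    [enc_unary j, enc_list enc_edge \<phi>, enc_cedges ms, enc_cedges es]
    (enc_cedges (solution j \<phi>)) (t_solution N)"
proof -
  let ?L = "stage_edges j \<phi>" and ?M = "filter (consistent \<phi>) ms"
  have \<phi>: "\<forall>p\<in>set \<phi>. small N (fst p)" "length \<phi> \<le> 8 * N"
    using assms unfolding admissible_def by blast+
  have L: "computes_in stage_edges_fn
      [enc_unary j, enc_list enc_edge \<phi>, enc_cedges ms, enc_cedges es] (enc_cedges ?L)
      (Suc N * (3 * t_scan N + 200))"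
    unfolding stage_edges_def
  proof (rule computes_mono[OF stage_edges_computes[OF \<phi> _ small_es]])
    show "length ms \<le> 8 * N" using length_ms by simp
    show "Suc (length es) * (3 * t_scan N + 200) \<le> Suc N * (3 * t_scan N + 200)"
      using length_es by (intro mult_le_mono1) simp
  qed
  have M: "computes_in filter_consistent_fn [enc_list enc_edge \<phi>, enc_cedges ms] (enc_cedges ?M)
      (Suc N * (t_scan N + 100))"
  proof (rule computes_mono[OF filter_consistent_computes[OF \<phi> small_ms]])
    show "Suc (length ms) * (t_scan N + 100) \<le> Suc N * (t_scan N + 100)"
      using length_ms by (intro mult_le_mono1) simp
  qed
  have lenL: "length ?L \<le> N"
    unfolding stage_edges_def using length_filter_le length_es by (rule order_trans)
  have lenM: "length ?M \<le> N"
    using length_filter_le length_ms by (rule order_trans)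
  have smallL: "\<forall>e\<in>set ?L. small_edge N e"
    using small_es set_stage_edges_subset by blast
  have smallM: "\<forall>e\<in>set ?M. small_edge N e"
    using small_ms by simp
  have 1: "computes_in extend_fn [Atom, enc_cedges ?M] (enc_cedges (extend [] ?M)) (t_extend N)"
    using extend_computes'[OF smallM, of "[]"] lenM by simp
  have len1: "length (extend [] ?M) \<le> N + 2"
    using length_extend[of "[]" ?M] lenM by simp
  have 2: "computes_in extend_fn [enc_cedges (extend [] ?M), enc_cedges ?L]
      (enc_cedges (start j \<phi>)) (t_extend N)"
    unfolding start_def using extend_computes'[OF smallL len1] lenL by simp
  have 3: "computes_in local_search_fn [enc_cedges ?L, enc_cedges (start j \<phi>), enc_cedges ?L]
      (enc_cedges (local_search ?L (start j \<phi>) ?L)) (t_local_search N)"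
  proof (rule computes_mono[OF local_search_computes[OF smallL lenL start_props(1,2)]])
    show "Suc (length ?L) * (t_improve N + 100) \<le> t_local_search N"
      unfolding t_local_search_def using lenL by (intro mult_le_mono1) simp
  qed
  have "Suc N * (3 * t_scan N + 200) + Suc N * (t_scan N + 100) = Suc N * (4 * t_scan N + 300)"
    by (simp add: algebra_simps)
  then show ?thesis
    unfolding t_solution_def solution_def
    using L[THEN run_time_le] M[THEN run_time_le] 1[THEN run_time_le] 2[THEN run_time_le]
      3[THEN run_time_le]
    by (intro computes_prog)
      (simp_all add: prog_nth evals_with_simps L[THEN call_with_eq] M[THEN call_with_eq]
        1[THEN call_with_eq] 2[THEN call_with_eq] 3[THEN call_with_eq] del: mult_Suc)
qed

lemma critical_computes:
  fixes j :: nat and \<phi> :: "(nat \<times> nat) list"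
  defines "F \<equiv> solution j \<phi>"
  shows "computes_in critical_fn [enc_cedges ms, enc_cedges F] (enc_list enc_nat (critical F)) (t_critical N)"
proof -
  have F: "\<forall>e\<in>set F. small_edge N e" "length F \<le> N"
    unfolding F_def by (rule small_solution length_solution)+
  have len: "length (surplus F) \<le> N" "length (disturbed F) \<le> N"
    using order_trans[OF length_filter_le F(2)] order_trans[OF length_filter_le length_ms]
    unfolding surplus_def disturbed_def by auto
  have S: "computes_in surplus_fn [enc_cedges ms, enc_cedges F] (enc_cedges (surplus F))
      (Suc N * (t_scan N + 100))"
    unfolding surplus_def
    by (rule computes_mono[OF surplus_computes[OF _ F(1)]], use length_ms in simp)
      (intro mult_le_mono1, use F(2) in simp)
  have D: "computes_in disturbed_fn [enc_cedges F, enc_cedges (surplus F), enc_cedges ms]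
      (enc_cedges (disturbed F)) (Suc N * (2 * t_scan N + 150))"
    unfolding disturbed_def
    by (rule computes_mono[OF disturbed_computes[OF _ _ small_ms]], insert F(2) len(1) length_ms)
      simp_all
  have E1: "computes_in endpoints_fn [enc_cedges (disturbed F), Atom]
      (enc_list enc_nat (endpoints (disturbed F) [])) (100 * N + 100)"
    using computes_mono[OF endpoints_computes[of "disturbed F" "[]"], of "100 * N + 100"] len(2) by simp
  have E2: "computes_in endpoints_fn
      [enc_cedges (surplus F), enc_list enc_nat (endpoints (disturbed F) [])]
      (enc_list enc_nat (critical F)) (100 * N + 100)"
    unfolding critical_def
    by (rule computes_mono[OF endpoints_computes]) (use len(1) in simp)
  have "Suc N * (t_scan N + 100) + Suc N * (2 * t_scan N + 150) + (100 * N + 100) + (100 * N + 100)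
      = Suc N * (3 * t_scan N + 450)"
    by (simp add: algebra_simps)
  then show ?thesis
    unfolding t_critical_def
    using S[THEN run_time_le] D[THEN run_time_le] E1[THEN run_time_le] E2[THEN run_time_le]
    by (intro computes_prog)
      (simp_all add: prog_nth evals_with_simps S[THEN call_with_eq] D[THEN call_with_eq]
        E1[THEN call_with_eq] E2[THEN call_with_eq] del: mult_Suc)
qed

abbreviation "q \<equiv> max 1 (length cs)"
abbreviation "d \<equiv> k - length ms"

abbreviation "context_data \<equiv> [enc_cedges ms, enc_cedges es, enc_list enc_nat cs, enc_nat k]"

text \<open>The overhead of inner nodes is charged to the leaves: no level has more than
  \<open>q ^ length xs\<close> nodes, so each level costs at most a constant per leaf.\<close>

lemma branch_computes:
  assumes S: "\<And>\<psi>. \<forall>p\<in>set \<psi>. small N (fst p) \<Longrightarrow> length \<psi> = length \<phi> + length xs \<Longrightarrow>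
      computes_in search_fn (enc_unary j # enc_list enc_edge \<psi> # context_data)
        (enc_bool (search j \<psi>)) B"
    and "\<forall>p\<in>set \<phi>. small N (fst p)" "\<forall>x\<in>set xs. small N x"
  shows "computes_in branch_fn
    (enc_list enc_nat xs # enc_unary j # enc_list enc_edge \<phi> # context_data)
    (enc_bool (branch cs (search j) xs \<phi>)) (q ^ length xs * (B + 200 * Suc (length xs)))"
  using assms
proof (induction xs arbitrary: \<phi>)
  case Nil
  have "computes_in search_fn (enc_unary j # enc_list enc_edge \<phi> # context_data)
      (enc_bool (search j \<phi>)) B"
    using Nil by simp
  note this[THEN call_with_eq] this[THEN run_time_le]
  then show ?case
    by (intro computes_prog) (simp_all add: prog_nth evals_with_simps)
next
  case (Cons x xs)
  let ?B = "q ^ length xs * (B + 200 * Suc (length xs))"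
  have IH: "computes_in branch_fn
    (enc_list enc_nat xs # enc_unary j # Pair (Pair (enc_nat x) (enc_nat c)) (enc_list enc_edge \<phi>)
      # context_data)
    (enc_bool (branch cs (search j) xs ((x, c) # \<phi>))) ?B" for c
    using Cons.IH[of "(x, c) # \<phi>"] Cons.prems by simp
  have colours: "computes_in colours_fn
    (enc_list enc_nat rest # Pair (enc_nat x) (enc_list enc_nat xs) # enc_unary j
      # enc_list enc_edge \<phi> # context_data)
    (enc_bool (\<exists>c\<in>set rest. branch cs (search j) xs ((x, c) # \<phi>)))
    (length rest * (?B + 120) + 20)" for rest
  proof (induction rest)
    case Nil
    show ?case
      by (intro computes_prog) (simp_all add: prog_nth evals_with_simps)
  next
    case (Cons c rest)
    show ?case
      using Cons.IH[THEN run_time_le] IH[of c, THEN run_time_le]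
      by (intro computes_prog)
        (simp_all add: prog_nth evals_with_simps Cons.IH[THEN call_with_eq] IH[THEN call_with_eq])
  qed
  \<comment> \<open>The constant cost of the node itself is absorbed by \<open>q\<close>, which is
    at least \<open>1\<close> even if there are no colours.\<close>
  have "length cs * (?B + 120) + 80 \<le> q * (?B + 120) + q * 80"
    by (intro add_mono mult_le_mono1) simp_all
  also have "\<dots> = q * ?B + q * 200"
    by (simp add: add_mult_distrib2)
  also have "\<dots> = q * ?B + q * 1 * 200"
    by (simp only: mult_1_right)
  also have "\<dots> \<le> q * ?B + q * q ^ length xs * 200"
    by (intro add_left_mono mult_le_mono1 mult_le_mono2 one_le_power) simp
  also have "\<dots> = q ^ length (x # xs) * (B + 200 * Suc (length (x # xs)))"
    by (simp add: algebra_simps)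
  finally have "length cs * (?B + 120) + 80 \<le> q ^ length (x # xs) * (B + 200 * Suc (length (x # xs)))" .
  then show ?case
    using colours[of cs, THEN run_time_le]
    by (intro computes_prog)
      (simp_all add: prog_nth evals_with_simps colours[THEN call_with_eq] del: power.simps mult_Suc mult_Suc_right)
qed

text \<open>Here \<open>n\<close> is the number of vertices coloured so far;
  \<open>41 * n + 38 * d\<close> adds the at most \<open>40 * n + 38 * d\<close> new critical ones.
  The overhead of branching uses the bound \<open>4 * N\<close> instead.\<close>

fun search_bound :: "nat \<Rightarrow> nat \<Rightarrow> nat" where
  "search_bound 0 n = t_search N"
| "search_bound (Suc j) n =
     t_search N + q ^ (40 * n + 38 * d) * (search_bound j (41 * n + 38 * d) + 200 * Suc (4 * N))"

lemma search_bound_mono: "m \<le> n \<Longrightarrow> search_bound j m \<le> search_bound j n"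
proof (induction j arbitrary: m n)
  case (Suc j)
  have "search_bound j (41 * m + 38 * d) \<le> search_bound j (41 * n + 38 * d)"
    using Suc.prems by (intro Suc.IH) simp
  moreover have "q ^ (40 * m + 38 * d) \<le> q ^ (40 * n + 38 * d)"
    using Suc.prems by (intro power_increasing) simp_all
  ultimately show ?case
    unfolding search_bound.simps by (intro add_mono mult_le_mono) simp_all
qed simp

text \<open>The invariant reserves \<open>4 * N\<close> places for each branching still to come, so
  that colourings never outgrow the \<open>8 * N\<close> assumed by the scans.\<close>

lemma search_computes:
  assumes "\<forall>p\<in>set \<phi>. small N (fst p)" "length \<phi> + 4 * N * j \<le> 8 * N"
  shows "computes_in search_fn (enc_unary j # enc_list enc_edge \<phi> # context_data)
    (enc_bool (search j \<phi>)) (search_bound j (length \<phi>))"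
  using assms
proof (induction j arbitrary: \<phi>)
  case 0
  then have "admissible \<phi>" by (simp add: admissible_def)
  note sol = solution_computes[OF this, of 0]
  have al: "computes_in at_least_fn [enc_nat k, enc_cedges (solution 0 \<phi>)]
      (enc_bool (k \<le> length (solution 0 \<phi>))) (Suc N * (40 * N + 200))"
    by (rule computes_mono[OF at_least_computes[OF length_solution]])
      (intro mult_le_mono1, use size_k in simp)
  show ?case
    using sol[THEN run_time_le] al[THEN run_time_le] sol[THEN call_with_eq] al[THEN call_with_eq]
    by (intro computes_prog)
      (simp_all add: prog_nth evals_with_simps t_search_def del: mult_Suc)
next
  case (Suc j)
  then have "admissible \<phi>" by (simp add: admissible_def)
  note sol = solution_computes[OF this, of "Suc j", unfolded enc_unary.simps]
  let ?F = "solution (Suc j) \<phi>"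
  let ?X = "critical ?F"
  have al: "computes_in at_least_fn [enc_nat k, enc_cedges ?F]
      (enc_bool (k \<le> length ?F)) (Suc N * (40 * N + 200))"
    by (rule computes_mono[OF at_least_computes[OF length_solution]])
      (intro mult_le_mono1, use size_k in simp)
  note crit = critical_computes[of "Suc j" \<phi>]
  show ?case
  proof (cases "k \<le> length ?F")
    case True
    then show ?thesis
      using sol[THEN run_time_le] al[THEN run_time_le] sol[THEN call_with_eq] al[THEN call_with_eq]
      by (intro computes_prog)
        (simp_all add: prog_nth evals_with_simps t_search_def del: mult_Suc)
  next
    case False
    have X: "length ?X \<le> 40 * length \<phi> + 38 * d"
      using False by (intro length_critical) simp
    have X': "length ?X \<le> 4 * N"
      using length_critical_le[of "Suc j" \<phi>] length_es by linarith
    have "set ?X \<subseteq> (\<Union>e\<in>set es. ends e)"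
      using order_trans[OF solution_props(1)[of "Suc j" \<phi>] set_stage_edges_subset] ms_subset
      unfolding critical_def set_endpoints surplus_def disturbed_def set_filter by auto
    then have smallX: "\<forall>x\<in>set ?X. small N x"
      using small_es unfolding small_edge_def by (force simp: ends_iff)
    have S: "computes_in search_fn (enc_unary j # enc_list enc_edge \<psi> # context_data)
        (enc_bool (search j \<psi>)) (search_bound j (41 * length \<phi> + 38 * d))"
      if \<psi>: "\<forall>p\<in>set \<psi>. small N (fst p)" "length \<psi> = length \<phi> + length ?X" for \<psi>
    proof (rule computes_mono[OF Suc.IH[OF \<psi>(1)]])
      show "length \<psi> + 4 * N * j \<le> 8 * N"
        using \<psi>(2) X' Suc.prems(2) by simp
      show "search_bound j (length \<psi>) \<le> search_bound j (41 * length \<phi> + 38 * d)"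
        using \<psi>(2) X by (intro search_bound_mono) simp
    qed
    let ?B = "q ^ (40 * length \<phi> + 38 * d) *
        (search_bound j (41 * length \<phi> + 38 * d) + 200 * Suc (4 * N))"
    have br: "computes_in branch_fn
      (enc_list enc_nat ?X # enc_unary j # enc_list enc_edge \<phi> # context_data)
      (enc_bool (branch cs (search j) ?X \<phi>)) ?B"
    proof (rule computes_mono[OF branch_computes[OF S Suc.prems(1) smallX]])
      show "q ^ length ?X * (search_bound j (41 * length \<phi> + 38 * d) + 200 * Suc (length ?X)) \<le> ?B"
        using X X' by (intro mult_le_mono add_mono power_increasing) simp_all
    qed
    show ?thesis
      using False sol[THEN run_time_le] al[THEN run_time_le] crit[THEN run_time_le]
        br[THEN run_time_le]
      unfolding search.simps search_bound.simps t_search_def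
      by (intro computes_prog)
        (simp_all add: prog_nth evals_with_simps sol[THEN call_with_eq] al[THEN call_with_eq]
          crit[THEN call_with_eq] br[THEN call_with_eq]
          del: mult_Suc mult_Suc_right search_bound.simps search.simps max_def)
  qed
qed

end

lemma same_edge_computes:
  assumes "small N (fst m)" "small N (snd m)"
  shows "computes_in same_edge_fn [enc_edge m, enc_cedge e] (enc_bool (edge_of m = ends e))
    (320 * N + 300)"
proof -
  obtain a b where m: "m = (a, b)" by (cases m)
  have eq: "edge_of m = ends e \<longleftrightarrow> a = fst (fst e) \<and> b = snd (fst e) \<or> a = snd (fst e) \<and> b = fst (fst e)"
    by (cases e; cases "fst e") (auto simp: m doubleton_eq_iff)
  have a: "small N a" and b: "small N b"
    using assms by (simp_all add: m)
  show ?thesis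
    unfolding eq
    using eq_time[OF a, of "enc_nat (fst (fst e))"] eq_time[OF a, of "enc_nat (snd (fst e))"]
      eq_time[OF b, of "enc_nat (fst (fst e))"] eq_time[OF b, of "enc_nat (snd (fst e))"]
    by (intro computes_prog) (auto simp: prog_nth evals_with_simps m call_eq)
qed

lemma listed_computes:
  assumes "\<forall>m\<in>set M. small N (fst m) \<and> small N (snd m)"
  shows "computes_in listed_fn [enc_list enc_edge M, enc_cedge e]
    (enc_bool (\<exists>m\<in>set M. edge_of m = ends e)) (Suc (length M) * (320 * N + 400))"
  using assms
proof (induction M)
  case Nil
  show ?case
    by (intro computes_prog) (simp_all add: prog_nth evals_with_simps)
next
  case (Cons m M)
  have IH: "computes_in listed_fn [enc_list enc_edge M, enc_cedge e]
    (enc_bool (\<exists>m\<in>set M. edge_of m = ends e)) (Suc (length M) * (320 * N + 400))"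
    using Cons by simp
  have same: "computes_in same_edge_fn [enc_edge m, enc_cedge e] (enc_bool (edge_of m = ends e))
    (320 * N + 300)"
    using Cons.prems by (intro same_edge_computes) simp_all
  have eq: "(\<exists>n\<in>set (m # M). edge_of n = ends e) \<longleftrightarrow>
      edge_of m = ends e \<or> (\<exists>m\<in>set M. edge_of m = ends e)"
    by simp
  show ?case
    unfolding eq
    using IH[THEN run_time_le] same[THEN run_time_le]
    by (intro computes_prog)
      (auto simp: prog_nth evals_with_simps same[THEN call_with_eq] IH[THEN call_with_eq])
qed

text \<open>The matching comes without colours and in arbitrary orientation. Selecting its edges
  from the coloured list makes membership in \<open>ms\<close> a plain equality of trees.\<close>

lemma select_computes:
  assumes "\<forall>m\<in>set M. small N (fst m) \<and> small N (snd m)" "length M \<le> 8 * N"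
  shows "computes_in select_fn [enc_list enc_edge M, enc_cedges es]
    (enc_cedges (filter (\<lambda>e. \<exists>m\<in>set M. edge_of m = ends e) es))
    (Suc (length es) * (t_scan N + 100))"
proof (induction es)
  case Nil
  show ?case
    by (intro computes_prog) (simp_all add: prog_nth evals_with_simps)
next
  case (Cons e es)
  have l: "computes_in listed_fn [enc_list enc_edge M, enc_cedge e]
    (enc_bool (\<exists>m\<in>set M. edge_of m = ends e)) (t_scan N)"
    by (rule computes_mono[OF listed_computes[OF assms(1)]])
      (use assms(2) in \<open>simp add: t_scan_def del: mult_Suc\<close>)
  show ?case
    using l[THEN run_time_le] Cons.IH[THEN run_time_le]
    by (intro computes_prog)
      (auto simp: prog_nth evals_with_simps l[THEN call_with_eq] Cons.IH[THEN call_with_eq])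
qed

context machine
begin

text \<open>The first branching has exponent \<open>38 * d\<close> and leaves that many coloured
  vertices; the second has exponent \<open>40 * 38 * d + 38 * d = 1558 * d\<close>. Their sum is
  \<open>1596 * d\<close>.\<close>

lemma search_bound_2: "search_bound 2 0 \<le> (3 * t_search N + 400 * Suc (4 * N)) * q ^ (1596 * d)"
proof -
  have q: "1 \<le> q ^ n" for n
    by (rule one_le_power) simp
  have collect: "t * x + (t + u) * x + (t + u) * x = (3 * t + 2 * u) * x" for t u x :: nat
    by (simp add: algebra_simps)
  let ?K = "200 * Suc (4 * N)" and ?T = "t_search N"
  have "search_bound (Suc 0) (38 * d) = ?T + q ^ (1558 * d) * (?T + ?K)"
    by simp
  then have "search_bound 2 0 = ?T + q ^ (38 * d) * (?T + q ^ (1558 * d) * (?T + ?K) + ?K)"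
    by (simp add: numeral_2_eq_2)
  also have "\<dots> = ?T + (?T + ?K) * q ^ (38 * d) + (?T + ?K) * (q ^ (38 * d) * q ^ (1558 * d))"
    by (simp only: add_mult_distrib2 ac_simps)
  also have "q ^ (38 * d) * q ^ (1558 * d) = q ^ (1596 * d)"
    by (simp only: power_add[symmetric]) simp
  also have "?T + (?T + ?K) * q ^ (38 * d) + (?T + ?K) * q ^ (1596 * d)
      \<le> ?T * q ^ (1596 * d) + (?T + ?K) * q ^ (1596 * d) + (?T + ?K) * q ^ (1596 * d)"
  proof (intro add_mono mult_le_mono le_refl)
    show "?T \<le> ?T * q ^ (1596 * d)"
      using mult_le_mono2[OF q, of ?T "1596 * d"] by (simp only: mult_1_right)
    show "q ^ (38 * d) \<le> q ^ (1596 * d)"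
      by (rule power_increasing) simp_all
  qed
  also have "\<dots> = (3 * ?T + 2 * ?K) * q ^ (1596 * d)"
    by (rule collect)
  finally show ?thesis
    by simp
qed

end

section \<open>The time bound\<close>

text \<open>Zero is left out because raising the exponent, as for sums, may decrease the bound
  there; encoded inputs have positive size.\<close>

definition poly_bounded :: "(nat \<Rightarrow> nat) \<Rightarrow> bool" where
  "poly_bounded f \<longleftrightarrow> (\<exists>a b. \<forall>n\<ge>1. f n \<le> a * n ^ b)"

lemma poly_bounded_const: "poly_bounded (\<lambda>n. c)"
  unfolding poly_bounded_def by (intro exI[of _ c] exI[of _ 0]) simp

lemma poly_bounded_id: "poly_bounded (\<lambda>n. n)"
  unfolding poly_bounded_def by (intro exI[of _ 1] exI[of _ 1]) simp

lemma poly_bounded_add: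
  assumes "poly_bounded f" "poly_bounded g"
  shows "poly_bounded (\<lambda>n. f n + g n)"
proof -
  obtain a b a' b' where *: "\<forall>n\<ge>1. f n \<le> a * n ^ b" "\<forall>n\<ge>1. g n \<le> a' * n ^ b'"
    using assms unfolding poly_bounded_def by blast
  have "f n + g n \<le> (a + a') * n ^ (b + b')" if "1 \<le> n" for n
  proof -
    have "f n + g n \<le> a * n ^ b + a' * n ^ b'"
      using * that by (intro add_mono) simp_all
    also have "\<dots> \<le> a * n ^ (b + b') + a' * n ^ (b + b')"
      using that by (intro add_mono mult_le_mono2 power_increasing) simp_all
    finally show ?thesis by (simp add: add_mult_distrib)
  qed
  then show ?thesis unfolding poly_bounded_def by blast
qed

lemma poly_bounded_mult:
  assumes "poly_bounded f" "poly_bounded g"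
  shows "poly_bounded (\<lambda>n. f n * g n)"
proof -
  obtain a b a' b' where *: "\<forall>n\<ge>1. f n \<le> a * n ^ b" "\<forall>n\<ge>1. g n \<le> a' * n ^ b'"
    using assms unfolding poly_bounded_def by blast
  have "f n * g n \<le> (a * a') * n ^ (b + b')" if "1 \<le> n" for n
  proof -
    have "f n * g n \<le> (a * n ^ b) * (a' * n ^ b')"
      using * that by (intro mult_le_mono) simp_all
    then show ?thesis by (simp add: power_add ac_simps)
  qed
  then show ?thesis unfolding poly_bounded_def by blast
qed

lemma poly_bounded_Suc: "poly_bounded f \<Longrightarrow> poly_bounded (\<lambda>n. Suc (f n))"
  using poly_bounded_add[of f "\<lambda>n. 1"] poly_bounded_const by simp

definition t_total :: "nat \<Rightarrow> nat" where
  "t_total N = 3 * t_search N + 400 * Suc (4 * N) + Suc N * (t_scan N + 100) + 200"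

lemma poly_bounded_t_total: "poly_bounded t_total"
  unfolding t_total_def[abs_def] t_search_def t_solution_def t_critical_def
    t_local_search_def t_improve_def t_improve_with_def t_extend_def t_blocked_def t_scan_def
  by (intro poly_bounded_add poly_bounded_mult poly_bounded_Suc poly_bounded_const poly_bounded_id)

lemma length_le_size_enc_list: "length xs \<le> size (enc_list enc xs)"
  by (induction xs) auto

lemma size_le_size_enc_list: "x \<in> set xs \<Longrightarrow> size (enc x) \<le> size (enc_list enc xs)"
  by (induction xs) (auto intro: trans_le_add1 trans_le_add2)

lemma runs_main:
  assumes "machine es (filter (\<lambda>e. \<exists>m\<in>set M. edge_of m = ends e) es) k N"
    and "\<forall>m\<in>set M. small N (fst m) \<and> small N (snd m)" "length M \<le> N"
  defines "ms \<equiv> filter (\<lambda>e. \<exists>m\<in>set M. edge_of m = ends e) es"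
  shows "\<exists>t. t \<le> t_total N * max 1 (length cs) ^ (1596 * (k - length ms)) \<and>
    runs prog (Pair V (Pair (enc_cedges es) (Pair (enc_list enc_nat cs)
        (Pair (enc_nat k) (enc_list enc_edge M)))))
      (enc_bool (clustering.search es ms cs k 2 [])) t"
    (is "\<exists>t. t \<le> _ \<and> runs prog ?x ?v t")
proof -
  interpret machine es ms cs k N
    using assms(1) unfolding ms_def .
  have sel: "computes_in select_fn [enc_list enc_edge M, enc_cedges es] (enc_cedges ms)
      (Suc N * (t_scan N + 100))"
  proof (rule computes_mono[OF select_computes[OF assms(2), of es, folded ms_def]])
    show "length M \<le> 8 * N" using assms(3) by simp
    show "Suc (length es) * (t_scan N + 100) \<le> Suc N * (t_scan N + 100)"
      using length_es by (intro mult_le_mono1) simp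
  qed
  have srch: "computes_in search_fn
      [Pair Atom (Pair Atom Atom), Atom, enc_cedges ms, enc_cedges es, enc_list enc_nat cs, enc_nat k]
      (enc_bool (search 2 [])) (search_bound 2 0)"
    using search_computes[of "[]" 2] by (simp add: numeral_2_eq_2 del: search.simps search_bound.simps)
  have main: "computes_in main_fn [?x] ?v
      (Suc N * (t_scan N + 100) + search_bound 2 0 + 100)"
    using sel[THEN run_time_le] srch[THEN run_time_le]
    by (intro computes_prog)
      (simp_all add: prog_nth evals_with_simps sel[THEN call_with_eq] srch[THEN call_with_eq]
        del: mult_Suc)
  have "evals_with prog [?x] (Call main_fn [Var 0])
      (\<lambda>v t. v = ?v \<and> t \<le> Suc N * (t_scan N + 100) + search_bound 2 0 + 200)"
    using main[THEN run_time_le]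
    by (simp add: evals_with_simps main[THEN call_with_eq] del: mult_Suc)
  then obtain t where t: "runs prog ?x ?v t"
      "t \<le> Suc N * (t_scan N + 100) + search_bound 2 0 + 200"
    unfolding evals_with_def runs_def by blast
  have collect: "(u + 200) * y + (v + w) * y = (v + w + u + 200) * y" for u v w y :: nat
    by (simp add: algebra_simps)
  let ?p = "q ^ (1596 * d)" and ?s = "Suc N * (t_scan N + 100) + 200"
  have "?s * 1 \<le> ?s * ?p"
    by (intro mult_le_mono2 one_le_power) simp
  then have "?s + search_bound 2 0 \<le> ?s * ?p + (3 * t_search N + 400 * Suc (4 * N)) * ?p"
    using search_bound_2 by (intro add_mono) (simp_all only: mult_1_right)
  also have "\<dots> = t_total N * ?p"
    unfolding t_total_def by (rule collect)
  finally have "t \<le> t_total N * ?p"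
    using t(2) by linarith
  with t(1) show ?thesis by blast
qed

text \<open>An edge that meets two different pairs has one end in each, as the pairs are disjoint;
  it therefore joins them, which an induced matching forbids.\<close>

lemma clustering_instance:
  fixes l :: "'v set \<Rightarrow> 'c"
  assumes G: "simple_graph V E" and es: "lists_edges es0 E" and M: "induced_matching E M"
    and M0: "lists_edges M0 M"
  defines "es \<equiv> map (\<lambda>p. (p, l (edge_of p))) es0"
  defines "ms \<equiv> filter (\<lambda>e. \<exists>m\<in>set M0. edge_of m = ends e) es"
  shows "clustering es ms" and "inj_on ends (set es)" and "ends ` set es = E"
    and "length ms = card M" and "\<And>e. e \<in> set es \<Longrightarrow> snd e = l (ends e)"
proof -
  have dist: "distinct (map edge_of es0)" and E: "edge_of ` set es0 = E"
    and M_eq: "edge_of ` set M0 = M"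
    using es M0 unfolding lists_edges_def by blast+
  have inj0: "inj_on edge_of (set es0)" and d0: "distinct es0"
    using dist by (simp_all add: distinct_map)
  show snd: "snd e = l (ends e)" if "e \<in> set es" for e
    using that unfolding es_def by (auto simp: ends_def)
  show inj: "inj_on ends (set es)"
    using inj0 unfolding es_def by (auto simp: inj_on_def ends_def)
  show img: "ends ` set es = E"
    unfolding es_def using E by (simp add: image_image ends_def)
  have dist_es: "distinct es"
    unfolding es_def using d0 by (simp add: distinct_map inj_on_def)
  have ms_iff: "e \<in> set ms \<longleftrightarrow> e \<in> set es \<and> ends e \<in> M" for e
    unfolding ms_def using M_eq by auto
  have M_sub: "M \<subseteq> E" and M_disj: "\<And>a b. a \<in> M \<Longrightarrow> b \<in> M \<Longrightarrow> a \<noteq> b \<Longrightarrow> a \<inter> b = {}"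
    and M_ind: "\<And>a b u v. a \<in> M \<Longrightarrow> b \<in> M \<Longrightarrow> a \<noteq> b \<Longrightarrow> u \<in> a \<Longrightarrow> v \<in> b \<Longrightarrow> {u, v} \<notin> E"
    using M unfolding induced_matching_def matching_def by blast+
  show "clustering es ms"
  proof
    show "distinct es" by (rule dist_es)
    show "distinct ms" unfolding ms_def using dist_es by (rule distinct_filter)
    show "set ms \<subseteq> set es" unfolding ms_def by simp
    fix e p r
    assume e: "e \<in> set es" and p: "p \<in> set ms" and r: "r \<in> set ms"
      and ep: "ends e \<inter> ends p \<noteq> {}" and er: "ends e \<inter> ends r \<noteq> {}"
    have pM: "ends p \<in> M" and rM: "ends r \<in> M" and pes: "p \<in> set es" and res: "r \<in> set es"
      using p r ms_iff by blast+
    have "ends p = ends r"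
    proof (rule ccontr)
      assume ne: "ends p \<noteq> ends r"
      obtain u v where u: "u \<in> ends e" "u \<in> ends p" and v: "v \<in> ends e" "v \<in> ends r"
        using ep er by blast
      have "u \<noteq> v" using M_disj[OF pM rM ne] u v by blast
      then have "ends e = {u, v}"
        using u(1) v(1) by (cases e; cases "fst e") auto
      moreover have "ends e \<in> E" using e img by blast
      ultimately show False
        using M_ind[OF pM rM ne u(2) v(2)] by simp
    qed
    then show "p = r" using inj pes res by (simp add: inj_on_eq_iff)
  qed
  have "ends ` set ms = M"
  proof
    show "ends ` set ms \<subseteq> M" using ms_iff by blast
    show "M \<subseteq> ends ` set ms"
    proof
      fix m assume m: "m \<in> M"
      then obtain e where "e \<in> set es" "m = ends e" using M_sub img by blast
      with m show "m \<in> ends ` set ms" using ms_iff[of e] by simp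
    qed
  qed
  moreover have "card (ends ` set ms) = card (set ms)"
    using inj ms_iff by (intro card_image inj_on_subset[OF inj]) blast
  moreover have "distinct ms"
    unfolding ms_def using dist_es by (rule distinct_filter)
  ultimately show "length ms = card M"
    by (simp add: distinct_card)
qed

lemma colored_clustering_iff:
  assumes inj: "inj_on ends (set es)" and img: "ends ` set es = E"
    and col: "\<And>e. e \<in> set es \<Longrightarrow> snd e = l (ends e)"
  shows "colored_clustering E l k \<longleftrightarrow> (\<exists>F. F \<subseteq> set es \<and> conflict_free F \<and> k \<le> card F)"
proof
  assume "colored_clustering E l k"
  then obtain F where F: "F \<subseteq> E" "stable l F" "k \<le> card F"
    unfolding colored_clustering_def by blast
  define G where "G = {e\<in>set es. ends e \<in> F}"
  have "ends ` G = F"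
    unfolding G_def using F(1) img by blast
  moreover have "card (ends ` G) = card G"
    by (intro card_image inj_on_subset[OF inj]) (simp add: G_def)
  moreover have "conflict_free G"
    unfolding conflict_free_def conflict_def
  proof (intro ballI)
    fix e f assume "e \<in> G" "f \<in> G"
    then have e: "e \<in> set es" "ends e \<in> F" and f: "f \<in> set es" "ends f \<in> F"
      unfolding G_def by blast+
    have "l (ends e) = l (ends f)" if "ends e \<inter> ends f \<noteq> {}"
      using F(2)[unfolded stable_def, THEN bspec, OF e(2), THEN bspec, OF f(2)] that by (rule mp)
    then show "\<not> (ends e \<inter> ends f \<noteq> {} \<and> snd e \<noteq> snd f)"
      unfolding col[OF e(1)] col[OF f(1)] by (intro notI) (elim conjE, blast)
  qed
  moreover have "G \<subseteq> set es" unfolding G_def by blast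
  ultimately show "\<exists>F. F \<subseteq> set es \<and> conflict_free F \<and> k \<le> card F"
    using F(3) by metis
next
  assume "\<exists>F. F \<subseteq> set es \<and> conflict_free F \<and> k \<le> card F"
  then obtain G where G: "G \<subseteq> set es" "conflict_free G" "k \<le> card G" by blast
  have "card (ends ` G) = card G"
    by (intro card_image inj_on_subset[OF inj G(1)])
  moreover have "ends ` G \<subseteq> E" using G(1) img by blast
  moreover have "stable l (ends ` G)"
    unfolding stable_def
  proof (intro ballI impI)
    fix a b assume "a \<in> ends ` G" "b \<in> ends ` G" and ab: "a \<inter> b \<noteq> {}"
    then obtain e f where e: "e \<in> G" "a = ends e" and f: "f \<in> G" "b = ends f" by blast
    then have "snd e = snd f"
      using G(2) ab unfolding conflict_free_def conflict_def by blast
    then show "l a = l b"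
      using col[OF subsetD[OF G(1) e(1)]] col[OF subsetD[OF G(1) f(1)]]
      unfolding e(2) f(2) by simp
  qed
  ultimately show "colored_clustering E l k"
    unfolding colored_clustering_def using G(3) by metis
qed

lemma induced_matching_number_eq:
  assumes "simple_graph V E" "maximum_induced_matching E M"
  shows "induced_matching_number E = card M"
  unfolding induced_matching_number_def
proof (rule Max_eqI)
  have "finite E"
    using assms(1) unfolding simple_graph_def by (meson finite_Pow_iff finite_subset PowI subsetI)
  moreover have "{M. induced_matching E M} \<subseteq> Pow E"
    unfolding induced_matching_def matching_def by blast
  ultimately show "finite (card ` {M. induced_matching E M})"
    by (meson finite_Pow_iff finite_imageI finite_subset)
  show "card M \<in> card ` {M. induced_matching E M}" "\<And>y. y \<in> card ` {M. induced_matching E M} \<Longrightarrow> y \<le> card M"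
    using assms(2) unfolding maximum_induced_matching_def by auto
qed

theorem theorem5:
  "\<exists>(P :: program) (a :: nat) (b :: nat) (c :: nat).
     \<forall>(V :: nat set) (E :: nat set set) (C :: nat set) (l :: nat set \<Rightarrow> nat) (k :: nat)
       (M :: nat set set) (x :: data).
       simple_graph V E \<and> finite C \<and> l ` E \<subseteq> C \<and>
       maximum_induced_matching E M \<and> encodes x V E C l k M \<longrightarrow>
       (\<exists>t. t \<le> O_star_bound a b c (size x) (card C) (k - induced_matching_number E) \<and>
            (if colored_clustering E l k then accepts P x t else rejects P x t))"
proof -
  obtain a b where ab: "\<And>n. 1 \<le> n \<Longrightarrow> t_total n \<le> a * n ^ b"
    using poly_bounded_t_total unfolding poly_bounded_def by blast
  show ?thesis
  proof (rule exI[of _ prog], rule exI[of _ a], rule exI[of _ b], rule exI[of _ 1596],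
      intro allI impI, elim conjE)
    fix V :: "nat set" and E :: "nat set set" and C :: "nat set" and l :: "nat set \<Rightarrow> nat"
      and k :: nat and M :: "nat set set" and x :: data
    assume G: "simple_graph V E" and lC: "l ` E \<subseteq> C"
      and max: "maximum_induced_matching E M" and enc: "encodes x V E C l k M"
    obtain vs es0 cs M0 where es0: "lists_edges es0 E" and cs: "distinct cs" "set cs = C"
      and M0: "lists_edges M0 M"
      and x: "x = Pair (enc_list enc_nat vs) (Pair (enc_list (enc_colored_edge l) es0)
        (Pair (enc_list enc_nat cs) (Pair (enc_nat k) (enc_list enc_edge M0))))"
      using enc unfolding encodes_def by blast
    define es where "es = map (\<lambda>p. (p, l (edge_of p))) es0"
    define ms where "ms = filter (\<lambda>e. \<exists>m\<in>set M0. edge_of m = ends e) es"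
    have M: "induced_matching E M"
      using max unfolding maximum_induced_matching_def by blast
    note inst = clustering_instance[OF G es0 M M0, where l = l, folded es_def, folded ms_def]
    have enc_es: "enc_list (enc_colored_edge l) es0 = enc_cedges es"
      unfolding es_def by (induction es0) (auto simp: enc_cedge_def)
    \<comment> \<open>The input size bounds all list lengths and all written lengths of numbers, so
      it serves as the single parameter of the machine.\<close>
    let ?N = "size x"
    have N_es: "size (enc_cedges es) \<le> ?N" and N_M: "size (enc_list enc_edge M0) \<le> ?N"
      and N_k: "size (enc_nat k) \<le> ?N" and N_1: "1 \<le> ?N"
      unfolding x enc_es by simp_all
    have small_es: "small_edge ?N e" if "e \<in> set es" for e
      using size_le_size_enc_list[OF that, of enc_cedge] N_es
      by (cases e; cases "fst e") (simp add: small_edge_def small_def enc_cedge_def)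
    have small_M: "small ?N (fst m) \<and> small ?N (snd m)" if "m \<in> set M0" for m
      using size_le_size_enc_list[OF that, of enc_edge] N_M
      by (cases m) (simp add: small_def)
    interpret machine es ms cs k ?N
    proof (intro machine.intro machine_axioms.intro inst(1))
      show "\<forall>e\<in>set es. small_edge ?N e" using small_es by blast
      show "length es \<le> ?N"
        using length_le_size_enc_list[of es enc_cedge] N_es by linarith
      show "size (enc_nat k) \<le> ?N" by (rule N_k)
    qed
    have "\<exists>t. t \<le> t_total ?N * max 1 (length cs) ^ (1596 * (k - length ms)) \<and>
        runs prog x (enc_bool (search 2 [])) t"
      using runs_main[where es = es and M = M0 and cs = cs and k = k and N = ?N
            and V = "enc_list enc_nat vs", folded ms_def] machine_axioms small_M
        length_le_size_enc_list[of M0 enc_edge] N_M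
      unfolding x[unfolded enc_es, symmetric] by (meson order_trans)
    then obtain t where t: "t \<le> t_total ?N * max 1 (length cs) ^ (1596 * (k - length ms))"
      and run: "runs prog x (enc_bool (search 2 [])) t"
      by blast
    have "colored_clustering E l k \<longleftrightarrow> search 2 []"
    proof -
      have colours: "snd ` set es \<subseteq> set cs"
      proof
        fix c assume "c \<in> snd ` set es"
        then obtain e where e: "e \<in> set es" "c = snd e" by blast
        have "ends e \<in> E" using inst(3) e(1) by blast
        then have "l (ends e) \<in> C" using lC by blast
        then show "c \<in> set cs" unfolding cs(2) e(2) inst(5)[OF e(1)] .
      qed
      have "search 2 [] \<longleftrightarrow> (\<exists>F. F \<subseteq> set es \<and> conflict_free F \<and> k \<le> card F)"
      proof
        show "search 2 []" if "\<exists>F. F \<subseteq> set es \<and> conflict_free F \<and> k \<le> card F"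
          using that by (elim exE conjE) (rule search_complete[OF _ _ _ colours])
      qed (rule search_sound)
      then show ?thesis
        using colored_clustering_iff[of es E l k, OF inst(2,3,5)] by (simp only:)
    qed
    moreover have "t \<le> O_star_bound a b 1596 ?N (card C) (k - induced_matching_number E)"
    proof -
      have "length cs = card C"
        using distinct_card[OF cs(1)] cs(2) by simp
      moreover have "length ms = induced_matching_number E"
        using inst(4) induced_matching_number_eq[OF G max] by simp
      moreover note order_trans[OF t mult_le_mono1[OF ab[OF N_1]]]
      ultimately show ?thesis
        unfolding O_star_bound_def by simp
    qed
    moreover have "if search 2 [] then accepts prog x t else rejects prog x t"
      using run unfolding accepts_def rejects_def by (cases "search 2 []") auto
    ultimately show "\<exists>t. t \<le> O_star_bound a b 1596 ?N (card C) (k - induced_matching_number E) \<and>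
        (if colored_clustering E l k then accepts prog x t else rejects prog x t)"
      by (intro exI[of _ t]) simp
  qed
qed

end
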